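(* Let $N\ge2$, let $\Omega\subset\mathbb{R}^N$ be an open and bounded set with sufficiently smooth boundary $\partial\Omega$, and let $u\in W^{1,t}(\Omega)$ with $t>N$. Let $p,q,s,\beta,\theta,\xi,\eta,\mu$ be parameters as specified in the context. Then there is a positive constant $c=c(t,\xi,\eta,\mu,p)$ such that for all $k\in\mathbb{R}$, $y\in\Omega$ and $r>0$ with $r<\mathrm{dist}(y,\partial\Omega)$, $$\sup_{B(y,\frac r2)}u\le k+d,$$ where $$d=\frac{c}{r^{\frac{\xi(p-1)}{\eta p}}}\left(\int_{A^+(k,r)}|u(x)-k|^t\,dx+r^t\int_{A^+(k,r)}|\nabla u(x)|^t\,dx\right)^{\frac{\xi(p-1)}{tp\eta}}\left(\int_{A^+(k,r)}|u(x)-k|^2\,dx\right)^{\frac{\xi(\theta-1)}{2\eta}}|A^+(k,r)|^{\frac{\theta-1}{2}} .$$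
   Context: $B(y,r)$ is the ball of center $y$ and radius $r$; $A^+(k,r)=A^+(y,k,r):=\{x: x\in B(y,r),\ u(x)>k\}$; $|\cdot|$ applied to sets is Lebesgue measure. Parameters: $p>1$ and $2<q<2p$; $s=\frac{2qN(p-1)}{N(2p-q)+2q(p-1)}$ (so $1<s<N$) and $s^*=\frac{Ns}{N-s}=\frac{2q(p-1)}{2p-q}$; $$\beta=1-\frac2q+\Big(1-\frac st\Big)\frac{s^*}{s}\,\frac{2p-q}{pq},\qquad \theta=\frac{1/p+\sqrt{1/p^2+4\beta}}{2}>1;$$ $\xi,\eta>0$ satisfy $\frac{\xi}{p}+\eta=\theta\xi$ and $\beta\xi=\theta\eta$; and $\mu=\dfrac{2\frac{p-1}{p}\xi+2\eta}{\theta-1}$. *)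

theory Defs
  imports "HOL-Analysis.Analysis" "HOL-Probability.Essential_Supremum"
begin

text \<open>Functions of class \<open>C\<^sup>m\<close> on the whole space: continuous for \<open>m = 0\<close>; for \<open>m + 1\<close>, differentiable
  everywhere with partial derivatives of class \<open>C\<^sup>m\<close>.\<close>

primrec Ck :: "nat \<Rightarrow> (real^'n::finite \<Rightarrow> real) \<Rightarrow> bool" where
  "Ck 0 f \<longleftrightarrow> continuous_on UNIV f"
| "Ck (Suc m) f \<longleftrightarrow> (\<exists>f'. (\<forall>x. GDERIV f x :> f' x) \<and> (\<forall>i. Ck m (\<lambda>x. f' x $ i)))"

text \<open>The boundary of \<open>\<Omega>\<close> is of class \<open>C\<^sup>m\<close>: near each boundary point, after a rotation taking some
  unit vector \<open>e\<close> to the last coordinate axis, \<open>\<Omega>\<close> is the region above the graph of a \<open>C\<^sup>m\<close> function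
  of the remaining coordinates. The vector \<open>x - (x \<bullet> e) *\<^sub>R e\<close> carries these coordinates, so
  only the values of \<open>\<gamma>\<close> on the hyperplane orthogonal to \<open>e\<close> matter.\<close>

definition Ck_boundary :: "nat \<Rightarrow> (real^'n::finite) set \<Rightarrow> bool" where
  "Ck_boundary m \<Omega> \<longleftrightarrow>
     (\<forall>x0\<in>frontier \<Omega>. \<exists>\<rho>>0. \<exists>e \<gamma>. norm e = 1 \<and> Ck m \<gamma> \<and>
        \<Omega> \<inter> ball x0 \<rho> = {x \<in> ball x0 \<rho>. x \<bullet> e > \<gamma> (x - (x \<bullet> e) *\<^sub>R e)})"

definition test_function :: "(real^'n::finite) set \<Rightarrow> (real^'n \<Rightarrow> real) \<Rightarrow> bool" where
  "test_function \<Omega> \<phi> \<longleftrightarrow>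
     (\<forall>m. Ck m \<phi>) \<and> compact (closure {x. \<phi> x \<noteq> 0}) \<and> closure {x. \<phi> x \<noteq> 0} \<subseteq> \<Omega>"

definition locally_integrable_on :: "(real^'n::finite \<Rightarrow> 'b::euclidean_space) \<Rightarrow> (real^'n) set \<Rightarrow> bool"
    (infixr "locally'_integrable'_on" 46) where
  "f locally_integrable_on \<Omega> \<longleftrightarrow> (\<forall>K. compact K \<and> K \<subseteq> \<Omega> \<longrightarrow> integrable (lebesgue_on K) f)"

definition weak_gradient ::
    "(real^'n::finite) set \<Rightarrow> (real^'n \<Rightarrow> real) \<Rightarrow> (real^'n \<Rightarrow> real^'n) \<Rightarrow> bool" where
  "weak_gradient \<Omega> u g \<longleftrightarrow>
     u locally_integrable_on \<Omega> \<and> g locally_integrable_on \<Omega> \<and>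
     (\<forall>\<phi> \<phi>'. test_function \<Omega> \<phi> \<and> (\<forall>x. GDERIV \<phi> x :> \<phi>' x) \<longrightarrow>
        (\<forall>i. (LINT x|lebesgue_on \<Omega>. u x * \<phi>' x $ i) = - (LINT x|lebesgue_on \<Omega>. g x $ i * \<phi> x)))"

definition Lp :: "real \<Rightarrow> (real^'n::finite) set \<Rightarrow> (real^'n \<Rightarrow> 'b::euclidean_space) set" where
  "Lp t \<Omega> = {f. f \<in> borel_measurable (lebesgue_on \<Omega>) \<and>
                integrable (lebesgue_on \<Omega>) (\<lambda>x. norm (f x) powr t)}"

text \<open>The elements are representatives, not classes modulo equality almost everywhere; values
  outside \<open>\<Omega>\<close> are irrelevant.\<close>

definition W1p :: "real \<Rightarrow> (real^'n::finite) set \<Rightarrow> (real^'n \<Rightarrow> real) set" where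
  "W1p t \<Omega> = {u. u \<in> Lp t \<Omega> \<and> (\<exists>g. weak_gradient \<Omega> u g \<and> g \<in> Lp t \<Omega>)}"

definition Aplus :: "(real^'n::finite \<Rightarrow> real) \<Rightarrow> real^'n \<Rightarrow> real \<Rightarrow> real \<Rightarrow> (real^'n) set" where
  "Aplus u y k r = {x \<in> ball y r. u x > k}"

text \<open>The supremum over a ball of an element of a Sobolev space: the essential supremum, which does
  not depend on the representative and is the ordinary supremum for a continuous one.\<close>

definition sup_ball :: "(real^'n::finite \<Rightarrow> real) \<Rightarrow> real^'n \<Rightarrow> real \<Rightarrow> ereal" where
  "sup_ball u y r = esssup (lebesgue_on (ball y r)) (\<lambda>x. ereal (u x))"

end

theory Submission
  imports Defs
begin

text \<open>
  The bound is a consequence of Morrey's inequality. Let \<open>\<alpha> = 1 - N / t > 0\<close>, and let \<open>H\<close> be the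
  continuous representative of \<open>u\<close> on the ball of radius \<open>r\<close> about \<open>y\<close>. On any smaller ball of
  radius \<open>\<rho>\<close> the oscillation of \<open>H\<close> is at most a constant times \<open>\<rho> powr \<alpha>\<close> times the \<open>t\<close>-norm of
  the gradient over that ball. Suppose that \<open>M = H x0 - k\<close> is positive at some \<open>x0\<close> in the ball of
  radius \<open>r / 2\<close>. Then \<open>H\<close> stays above \<open>k + M / 2\<close> on a ball about \<open>x0\<close> whose radius \<open>\<rho>\<close> satisfies
  \<open>\<rho> powr \<alpha> * \<Gamma> \<ge> \<kappa> * M\<close>. Here \<open>r * \<Gamma>\<close> is the \<open>t\<close>-th root of the sum of integrals in the bound,
  and \<open>\<kappa>\<close> depends on \<open>N\<close> and \<open>t\<close> only. This ball alone makes the measure of the superlevel set at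
  least a multiple of \<open>\<rho> powr N\<close>, and the integral of \<open>\<bar>u - k\<bar>\<^sup>2\<close> at least a multiple of
  \<open>M\<^sup>2 * \<rho> powr N\<close>. The exponents in the bound are such that all powers of \<open>\<rho>\<close>, \<open>\<Gamma>\<close> and \<open>M\<close> then
  combine to a multiple of \<open>M\<close> itself (\<open>interpolation_lower_bound\<close>, \<open>exponent_identities\<close>,
  \<open>sup_bound_continuous\<close>).

  The bound involves the gradient on the superlevel set only, and this is where the continuity of \<open>H\<close>
  helps. If the ball of radius \<open>\<rho>\<close> about \<open>x0\<close> left the superlevel set, then the largest ball about
  \<open>x0\<close> inside that set would have a point with \<open>H = k\<close> on its boundary, and Morrey's inequality on it
  would contradict the choice of \<open>\<rho>\<close> (\<open>ball_above_level\<close>).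

  Morrey's inequality is obtained directly from the definition of the weak gradient. For a vertex
  \<open>z\<close> in a ball, \<open>f\<close> is averaged over slices of the cone from \<open>z\<close> to a concentric smaller ball, with
  a smooth weight. The derivative of the weight in the slice parameter \<open>\<tau>\<close> is a divergence of test
  functions, so the derivative of the average is an integral of the gradient (\<open>DERIV_cone_average\<close>).
  By Hoelder's inequality it is at most a multiple of \<open>\<tau> powr (\<alpha> - 1)\<close>, which is integrable at \<open>0\<close>.
  The averages thus converge uniformly as \<open>\<tau>\<close> tends to \<open>0\<close>, and their distance from the value at
  \<open>\<tau> = 1\<close>, which is the same for all vertices, is bounded (\<open>Morrey_ball\<close>). That the limit is \<open>f\<close>
  follows by integration over boxes (\<open>cone_average_limit_AE\<close>). The same lemma shows that weak
  gradients are unique (\<open>weak_gradient_ball_unique\<close>), which transfers integrability from the gradient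
  in the definition of the Sobolev space to the given one.
\<close>

section \<open>Smooth bump functions\<close>

text \<open>The derivative of each of these functions is a combination of two others, at \<open>0\<close> as well as
  elsewhere. One derivative formula for the whole family therefore gives the smoothness of the
  classical bump, which is built from \<open>flat 0\<close>.\<close>

definition flat :: "nat \<Rightarrow> real \<Rightarrow> real" where
  "flat j s = (if s > 0 then inverse s ^ j * exp (- inverse s) else 0)"

lemma flat_nonneg: "0 \<le> flat j s"
  by (simp add: flat_def)

text \<open>With \<open>x = 1 / s\<close> this says that \<open>x ^ j / fact j\<close>, one term of the exponential series, is
  at most \<open>exp x\<close>.\<close>

lemma flat_le_fact: "flat j s \<le> fact j"
proof (cases "s > 0")
  case True
  define x where "x = inverse s"
  have x: "x > 0" using True by (simp add: x_def)
  have "x ^ j / fact j = (\<Sum>n\<in>{j}. x ^ n /\<^sub>R fact n)"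
    by (simp add: divide_inverse mult.commute)
  also have "\<dots> \<le> (\<Sum>n. x ^ n /\<^sub>R fact n)"
    using x by (intro sum_le_suminf summable_exp_generic) auto
  also have "\<dots> = exp x" by (simp add: exp_def)
  finally have "x ^ j * exp (- x) \<le> fact j"
    by (simp add: exp_minus divide_simps mult.commute)
  moreover have "flat j s = x ^ j * exp (- x)"
    using True by (simp add: flat_def x_def)
  ultimately show ?thesis by simp
qed (simp add: flat_def)

lemma flat_eq_power_mult: "flat j s = s ^ m * flat (j + m) s"
  by (simp add: flat_def power_add power_inverse)

text \<open>At \<open>0\<close> the difference quotient is \<open>h * flat (j + 2) h\<close>, which tends to \<open>0\<close> because
  \<open>flat (j + 2)\<close> is bounded.\<close>

lemma flat_deriv:
  "(flat j has_real_derivative flat (j + 2) s - real j * flat (j + 1) s) (at s)"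
proof -
  consider "s > 0" | "s = 0" | "s < 0" by linarith
  then show ?thesis
  proof cases
    case 1
    have "((\<lambda>s. inverse s ^ j * exp (- inverse s)) has_real_derivative flat (j + 2) s - real j * flat (j + 1) s) (at s)"
    proof -
      have inv: "(inverse has_real_derivative - (inverse s)\<^sup>2) (at s)"
        using 1 DERIV_inverse[of s UNIV] by (simp add: power2_eq_square)
      have "((\<lambda>y. y ^ j * exp (- y)) has_real_derivative
          (real j * y ^ (j - 1) * exp (- y) - y ^ j * exp (- y))) (at y)" for y :: real
        by (auto intro!: derivative_eq_intros)
      from DERIV_chain2[OF this inv] show ?thesis
      proof (rule DERIV_cong)
        show "(real j * inverse s ^ (j - 1) * exp (- inverse s) - inverse s ^ j * exp (- inverse s)) *
          - (inverse s)\<^sup>2 = flat (j + 2) s - real j * flat (j + 1) s"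
          using 1 by (cases j) (simp_all add: flat_def power2_eq_square algebra_simps)
      qed
    qed
    then show ?thesis
    proof (rule has_field_derivative_transform_within_open[of _ _ _ "{0<..}"])
      show "\<And>x. x \<in> {0<..} \<Longrightarrow> inverse x ^ j * exp (- inverse x) = flat j x"
        by (simp add: flat_def)
    qed (use 1 in auto)
  next
    case 2
    have "((\<lambda>h. flat j h / h) \<longlongrightarrow> 0) (at 0)"
    proof (rule Lim_null_comparison)
      show "\<forall>\<^sub>F h in at 0. norm (flat j h / h) \<le> \<bar>h\<bar> * fact (j + 2)"
      proof (rule eventually_mono[OF eventually_at_ball'[of 1]])
        fix h :: real assume h: "h \<in> ball 0 1 \<and> h \<noteq> 0 \<and> h \<in> UNIV"
        have "flat j h / h = h * flat (j + 2) h"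
          using h by (subst flat_eq_power_mult[of _ _ 2]) (simp add: power2_eq_square)
        then show "norm (flat j h / h) \<le> \<bar>h\<bar> * fact (j + 2)"
          using flat_nonneg[of "j + 2" h] flat_le_fact[of "j + 2" h]
          by (simp only: real_norm_def abs_mult) (intro mult_left_mono, auto)
      qed simp
      show "((\<lambda>h. \<bar>h\<bar> * fact (j + 2)) \<longlongrightarrow> 0) (at (0::real))"
        by (auto intro!: tendsto_eq_intros)
    qed
    then show ?thesis
      using 2 by (simp add: has_field_derivative_iff flat_def)
  next
    case 3
    have "((\<lambda>s. 0) has_real_derivative flat (j + 2) s - real j * flat (j + 1) s) (at s)"
      using 3 by (simp add: flat_def)
    then show ?thesis
    proof (rule has_field_derivative_transform_within_open[of _ _ _ "{..<0}"])
      show "\<And>x. x \<in> {..<0} \<Longrightarrow> 0 = flat j x"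
        by (simp add: flat_def)
    qed (use 3 in auto)
  qed
qed

lemma GDERIV_isCont: "GDERIV f x :> D \<Longrightarrow> isCont f x"
  unfolding gderiv_def by (rule has_derivative_continuous)

lemma Ck_continuous: "Ck m f \<Longrightarrow> continuous_on UNIV f"
proof (cases m)
  case (Suc l)
  assume "Ck m f"
  then obtain f' where "\<And>x. GDERIV f x :> f' x"
    unfolding Suc Ck.simps by blast
  then show ?thesis
    by (intro continuous_at_imp_continuous_on ballI) (rule GDERIV_isCont)
qed simp

lemma Ck_SucI:
  assumes "\<And>x. GDERIV f x :> f' x" "\<And>i. Ck m (\<lambda>x. f' x $ i)"
  shows "Ck (Suc m) f"
  unfolding Ck.simps using assms by blast

lemma Ck_Suc_imp: "Ck (Suc m) f \<Longrightarrow> Ck m f"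
proof (induction m arbitrary: f)
  case 0
  then show ?case using Ck_continuous[of "Suc 0" f] by simp
next
  case (Suc m)
  obtain f' where f': "\<And>x. GDERIV f x :> f' x" "\<And>i. Ck (Suc m) (\<lambda>x. f' x $ i)"
    using Suc.prems unfolding Ck.simps(2)[of "Suc m" f] by blast
  show ?case by (rule Ck_SucI[OF f'(1) Suc.IH[OF f'(2)]])
qed

lemma Ck_const: "Ck m (\<lambda>x. c)"
proof (induction m arbitrary: c)
  case (Suc m)
  show ?case by (rule Ck_SucI[of _ "\<lambda>_. 0"]) (simp_all add: GDERIV_const Suc)
qed simp

lemma Ck_add: "Ck m f \<Longrightarrow> Ck m g \<Longrightarrow> Ck m (\<lambda>x. f x + g x)"
proof (induction m arbitrary: f g)
  case 0
  then show ?case by (simp add: continuous_on_add)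
next
  case (Suc m)
  obtain f' where f': "\<And>x. GDERIV f x :> f' x" "\<And>i. Ck m (\<lambda>x. f' x $ i)"
    using Suc.prems(1) unfolding Ck.simps by blast
  obtain g' where g': "\<And>x. GDERIV g x :> g' x" "\<And>i. Ck m (\<lambda>x. g' x $ i)"
    using Suc.prems(2) unfolding Ck.simps by blast
  show ?case
    by (rule Ck_SucI[OF GDERIV_add[OF f'(1) g'(1)]]) (simp add: Suc.IH[OF f'(2) g'(2)])
qed

lemma Ck_mult: "Ck m f \<Longrightarrow> Ck m g \<Longrightarrow> Ck m (\<lambda>x. f x * g x)"
proof (induction m arbitrary: f g)
  case 0
  then show ?case by (simp add: continuous_on_mult)
next
  case (Suc m)
  obtain f' where f': "\<And>x. GDERIV f x :> f' x" "\<And>i. Ck m (\<lambda>x. f' x $ i)"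
    using Suc.prems(1) unfolding Ck.simps by blast
  obtain g' where g': "\<And>x. GDERIV g x :> g' x" "\<And>i. Ck m (\<lambda>x. g' x $ i)"
    using Suc.prems(2) unfolding Ck.simps by blast
  have "Ck m (\<lambda>x. f x * g' x $ i + g x * f' x $ i)" for i
    by (rule Ck_add[OF Suc.IH[OF Ck_Suc_imp[OF Suc.prems(1)] g'(2)]
          Suc.IH[OF Ck_Suc_imp[OF Suc.prems(2)] f'(2)]])
  then show ?case
    by (intro Ck_SucI[OF GDERIV_mult[OF f'(1) g'(1)]]) simp
qed

lemma GDERIV_component: "GDERIV (\<lambda>x. x $ i) x :> axis i 1"
  unfolding gderiv_def
  by (simp add: inner_axis bounded_linear_imp_has_derivative bounded_linear_vec_nth)

lemma Ck_component: "Ck m (\<lambda>x. x $ i)"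
proof (cases m)
  case (Suc l)
  then show ?thesis
    by (auto intro!: Ck_SucI[of _ "\<lambda>_. axis i 1"] GDERIV_component Ck_const simp del: Ck.simps)
qed (auto intro: continuous_intros)

lemma GDERIV_affine:
  assumes "GDERIV f (a *\<^sub>R x + v) :> D"
  shows "GDERIV (\<lambda>x. f (a *\<^sub>R x + v)) x :> a *\<^sub>R D"
proof -
  have "((\<lambda>x. f (a *\<^sub>R x + v)) has_derivative (\<lambda>h. (a *\<^sub>R h) \<bullet> D)) (at x)"
    using assms unfolding gderiv_def
    by (rule has_derivative_compose[of "\<lambda>x. a *\<^sub>R x + v" "\<lambda>h. a *\<^sub>R h", rotated])
       (auto intro!: derivative_eq_intros)
  then show ?thesis by (simp add: gderiv_def)
qed

lemma Ck_affine: "Ck m f \<Longrightarrow> Ck m (\<lambda>x. f (a *\<^sub>R x + v))"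
proof (induction m arbitrary: f)
  case 0
  then show ?case
    by (auto intro!: continuous_on_compose2[of UNIV f] continuous_intros)
next
  case (Suc m)
  obtain f' where f': "\<And>x. GDERIV f x :> f' x" "\<And>i. Ck m (\<lambda>x. f' x $ i)"
    using Suc.prems(1) by auto
  have *: "Ck m (\<lambda>x. (a *\<^sub>R f' (a *\<^sub>R x + v)) $ i)" for i
    using Ck_mult[OF Ck_const[of m a] Suc.IH[OF f'(2)[of i]]] by simp
  have "GDERIV (\<lambda>x. f (a *\<^sub>R x + v)) x :> a *\<^sub>R f' (a *\<^sub>R x + v)" for x
    by (intro GDERIV_affine f')
  from this * show ?case
    by (rule Ck_SucI)
qed

text \<open>The mollifier is a multiple of \<open>bump 0\<close>; the other indices occur because the gradient of
  \<open>bump j\<close> involves \<open>bump (j + 1)\<close> and \<open>bump (j + 2)\<close>.\<close>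

definition bump :: "nat \<Rightarrow> real^'n::finite \<Rightarrow> real" where
  "bump j x = flat j (1 - x \<bullet> x)"

definition bump_slope :: "nat \<Rightarrow> real^'n::finite \<Rightarrow> real" where
  "bump_slope j x = - 2 * (bump (j + 2) x - real j * bump (j + 1) x)"

lemma GDERIV_bump: "GDERIV (bump j) x :> bump_slope j x *\<^sub>R x"
proof -
  have "((\<lambda>y. y \<bullet> y) has_derivative (\<lambda>h. x \<bullet> h + h \<bullet> x)) (at x)"
    using has_derivative_inner[OF has_derivative_ident[of "at x"] has_derivative_ident[of "at x"]] .
  from has_derivative_diff[OF has_derivative_const[of 1] this]
  have "((\<lambda>y. 1 - y \<bullet> y) has_derivative (\<lambda>h. 0 - (x \<bullet> h + h \<bullet> x))) (at x)" .
  also have "(\<lambda>h. 0 - (x \<bullet> h + h \<bullet> x)) = (\<lambda>h. h \<bullet> (- 2 *\<^sub>R x))"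
  proof
    fix h
    have "x \<bullet> h = h \<bullet> x" by (rule inner_commute)
    then show "0 - (x \<bullet> h + h \<bullet> x) = h \<bullet> (- 2 *\<^sub>R x)" by (simp del: inner_commute)
  qed
  finally have "GDERIV (\<lambda>x. 1 - x \<bullet> x) x :> - 2 *\<^sub>R x"
    unfolding gderiv_def .
  from GDERIV_DERIV_compose[OF this flat_deriv[of j]] show ?thesis
    unfolding bump_def[abs_def] bump_slope_def scaleR_scaleR by (simp only: mult.commute)
qed

lemma Ck_bump: "Ck m (bump j :: real^'n::finite \<Rightarrow> real)"
proof (induction m arbitrary: j)
  case 0
  have "isCont (bump j) x" for x
    using GDERIV_bump GDERIV_isCont by blast
  then show ?case by (auto intro!: continuous_at_imp_continuous_on)
next
  case (Suc m)
  have "Ck m (bump_slope j :: real^'n \<Rightarrow> real)"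
    using Ck_add[OF Ck_mult[OF Ck_const[of m "- 2"] Suc.IH[of "j + 2"]]
        Ck_mult[OF Ck_const[of m "2 * real j"] Suc.IH[of "j + 1"]]]
    by (simp add: bump_slope_def[abs_def] algebra_simps)
  from Ck_mult[OF this Ck_component] have "Ck m (\<lambda>x. (bump_slope j x *\<^sub>R x) $ i)" for i :: 'n
    by simp
  then show ?case
    by (intro Ck_SucI[of _ "\<lambda>x. bump_slope j x *\<^sub>R x"] GDERIV_bump)
qed

lemma continuous_on_bump: "continuous_on A (bump j)"
  using Ck_continuous[OF Ck_bump] continuous_on_subset by blast

lemma bump_eq_0: "1 \<le> norm x \<Longrightarrow> bump j x = 0"
  by (simp add: bump_def flat_def not_less dot_square_norm one_le_power)

lemma integrable_bump: "integrable lborel (bump 0 :: real^'n::finite \<Rightarrow> real)"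
proof -
  have "integrable lborel (\<lambda>x::real^'n. indicator (cball 0 1) x *\<^sub>R bump 0 x)"
    by (intro borel_integrable_compact continuous_on_bump) auto
  moreover have "indicator (cball 0 1) x *\<^sub>R bump 0 x = bump 0 x" for x :: "real^'n"
    by (auto simp: indicator_def bump_eq_0)
  ultimately show ?thesis by (simp only:)
qed

lemma integral_bump_pos: "0 < (LINT x|lborel. bump 0 (x :: real^'n::finite))"
proof -
  have "(LINT x|lborel. bump 0 (x :: real^'n)) \<noteq> 0"
  proof
    assume "(LINT x|lborel. bump 0 (x :: real^'n)) = 0"
    then have "AE x in lborel. bump 0 (x :: real^'n) = 0"
      by (subst (asm) integral_nonneg_eq_0_iff_AE)
         (auto simp: integrable_bump bump_def flat_nonneg)
    then have "AE x in lborel. x \<notin> ball (0::real^'n) 1"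
    proof eventually_elim
      case (elim x)
      then have "1 \<le> (norm x)\<^sup>2"
        by (simp add: bump_def flat_def not_less dot_square_norm split: if_splits)
      then show ?case
        using power_less_one_iff[of "norm x" 2] by fastforce
    qed
    then have "emeasure lborel (ball (0::real^'n) 1) = 0"
      by (subst (asm) AE_iff_measurable[OF _ refl]) (auto simp: ball_def)
    then show False
      using unit_ball_vol_pos[of "real CARD('n)"] by (simp add: emeasure_ball)
  qed
  moreover have "0 \<le> (LINT x|lborel. bump 0 (x :: real^'n))"
    by (simp add: bump_def flat_nonneg)
  ultimately show ?thesis by simp
qed

definition mollifier :: "real^'n::finite \<Rightarrow> real" where
  "mollifier x = bump 0 x / (LINT y|lborel. bump 0 (y :: real^'n))"

definition mollifier_grad :: "real^'n::finite \<Rightarrow> real^'n" where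
  "mollifier_grad x = (bump_slope 0 x / (LINT y|lborel. bump 0 (y :: real^'n))) *\<^sub>R x"

text \<open>An upper bound of the mollifier (its value at the origin is smaller by the factor \<open>exp 1\<close>).
  It depends on the dimension alone, which is passed as a type.\<close>

definition mollifier_max :: "'n::finite itself \<Rightarrow> real" where
  "mollifier_max _ = 1 / (LINT y|lborel. bump 0 (y :: real^'n))"

lemma mollifier_max_pos: "0 < mollifier_max TYPE('n::finite)"
  using integral_bump_pos[where 'n='n] by (simp add: mollifier_max_def)

lemma mollifier_nonneg: "0 \<le> mollifier (x :: real^'n::finite)"
  using integral_bump_pos[where 'n='n] by (simp add: mollifier_def bump_def flat_nonneg)

lemma mollifier_le: "mollifier (x :: real^'n::finite) \<le> mollifier_max TYPE('n)"
  using integral_bump_pos[where 'n='n] flat_le_fact[of 0]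
  by (simp add: mollifier_def mollifier_max_def bump_def divide_right_mono)

lemma mollifier_eq_0: "1 \<le> norm x \<Longrightarrow> mollifier x = 0"
  by (simp add: mollifier_def bump_eq_0)

lemma integrable_mollifier: "integrable lborel (mollifier :: real^'n::finite \<Rightarrow> real)"
  using integrable_bump[where 'n='n] by (simp add: mollifier_def[abs_def])

lemma integral_mollifier: "(LINT x|lborel. mollifier (x :: real^'n::finite)) = 1"
  using integral_bump_pos[where 'n='n] by (simp add: mollifier_def[abs_def])

lemma Ck_mollifier: "Ck m (mollifier :: real^'n::finite \<Rightarrow> real)"
proof -
  have "Ck m (\<lambda>x. (1 / (LINT y|lborel. bump 0 (y :: real^'n))) * bump 0 x)"
    by (rule Ck_mult[OF Ck_const Ck_bump])
  then show ?thesis by (simp add: mollifier_def[abs_def])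
qed

lemma GDERIV_mollifier: "GDERIV mollifier (x :: real^'n::finite) :> mollifier_grad x"
proof -
  let ?I = "LINT y|lborel. bump 0 (y :: real^'n)"
  have "GDERIV (\<lambda>x. (1 / ?I) * bump 0 x) x :> (1 / ?I) *\<^sub>R (bump_slope 0 x *\<^sub>R x) + bump 0 x *\<^sub>R 0"
    by (rule GDERIV_mult[OF GDERIV_const GDERIV_bump])
  then show ?thesis
    by (simp add: mollifier_def[abs_def] mollifier_grad_def)
qed

lemma continuous_on_mollifier: "continuous_on A mollifier"
  using Ck_continuous[OF Ck_mollifier] continuous_on_subset by blast

lemma continuous_on_mollifier_grad: "continuous_on A (mollifier_grad :: real^'n::finite \<Rightarrow> real^'n)"
  unfolding mollifier_grad_def[abs_def] bump_slope_def[abs_def] divide_inverse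
  by (intro continuous_intros continuous_on_bump)

lemma norm_mollifier_grad_le:
  "norm (mollifier_grad (x :: real^'n::finite)) \<le> 4 * mollifier_max TYPE('n)"
proof (cases "1 \<le> norm x")
  case True
  then show ?thesis
    using mollifier_max_pos[where 'n='n] by (simp add: mollifier_grad_def bump_slope_def bump_eq_0)
next
  case False
  have "\<bar>bump_slope 0 x\<bar> \<le> 4"
    using flat_le_fact[of 2] flat_nonneg[of 2]
    by (simp add: bump_slope_def bump_def abs_mult fact_numeral numeral_2_eq_2)
  then have "\<bar>bump_slope 0 x\<bar> * norm x \<le> 4 * 1"
    using False by (intro mult_mono) auto
  then show ?thesis
    using integral_bump_pos[where 'n='n]
    by (simp add: mollifier_grad_def mollifier_max_def divide_right_mono)
qed

section \<open>Kernels on cones\<close>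

text \<open>Let \<open>z\<close> be the vertex of a cone over the ball \<open>B\<close> of radius \<open>R\<close> about \<open>c\<close>. The map
  \<open>e \<mapsto> z + \<tau> *\<^sub>R (e - z)\<close> sends \<open>B\<close> to a slice of the cone. \<open>cone_arg\<close> is its inverse,
  followed by \<open>e \<mapsto> (e - c) /\<^sub>R R\<close>, so that the mollifier can be applied to the result. As \<open>\<tau>\<close>
  decreases from \<open>1\<close> to \<open>0\<close>, the kernel below moves from a bump on \<open>B\<close>, the same for all \<open>z\<close>, to a
  point mass at \<open>z\<close>.\<close>

definition cone_arg :: "real^'n::finite \<Rightarrow> real \<Rightarrow> real^'n \<Rightarrow> real \<Rightarrow> real^'n \<Rightarrow> real^'n" where
  "cone_arg c R z \<tau> x = (1 / (\<tau> * R)) *\<^sub>R (x - z) + (1 / R) *\<^sub>R (z - c)"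

definition cone_kernel :: "real^'n::finite \<Rightarrow> real \<Rightarrow> real^'n \<Rightarrow> real \<Rightarrow> real^'n \<Rightarrow> real" where
  "cone_kernel c R z \<tau> x = (1 / (\<tau> * R)) ^ CARD('n) * mollifier (cone_arg c R z \<tau> x)"

text \<open>Up to the factor \<open>- 1 / \<tau>\<close> this is the derivative of the kernel in \<open>\<tau>\<close>; it is also the
  divergence in \<open>x\<close> of the kernel times \<open>x - z\<close>.\<close>

definition cone_kernel_slope :: "real^'n::finite \<Rightarrow> real \<Rightarrow> real^'n \<Rightarrow> real \<Rightarrow> real^'n \<Rightarrow> real" where
  "cone_kernel_slope c R z \<tau> x =
     (1 / (\<tau> * R)) ^ Suc CARD('n) * (mollifier_grad (cone_arg c R z \<tau> x) \<bullet> (x - z))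
     + real CARD('n) * cone_kernel c R z \<tau> x"

lemma cone_arg_affine:
  "cone_arg c R z \<tau> x = (1 / (\<tau> * R)) *\<^sub>R x + ((1 / R) *\<^sub>R (z - c) - (1 / (\<tau> * R)) *\<^sub>R z)"
  by (simp add: cone_arg_def scaleR_diff_right)

lemma cone_arg_eq:
  assumes "\<tau> \<noteq> 0"
  shows "cone_arg c R z \<tau> x = (1 / (\<tau> * R)) *\<^sub>R (x - (z + \<tau> *\<^sub>R (c - z)))"
  using assms by (simp add: cone_arg_def algebra_simps)

lemma cone_kernel_nonneg: "0 < \<tau> \<Longrightarrow> 0 < R \<Longrightarrow> 0 \<le> cone_kernel c R z \<tau> x"
  by (simp add: cone_kernel_def mollifier_nonneg)

lemma cone_kernel_le:
  fixes x :: "real^'n::finite"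
  shows "0 < \<tau> \<Longrightarrow> 0 < R \<Longrightarrow>
    cone_kernel c R z \<tau> x \<le> (1 / (\<tau> * R)) ^ CARD('n) * mollifier_max TYPE('n)"
  by (simp add: cone_kernel_def mollifier_le divide_right_mono)

lemma cone_kernel_support:
  assumes "0 < \<tau>" "0 < R" "cone_kernel c R z \<tau> x \<noteq> 0"
  shows "x \<in> ball (z + \<tau> *\<^sub>R (c - z)) (\<tau> * R)"
proof -
  have "norm (cone_arg c R z \<tau> x) < 1"
    using assms(3) mollifier_eq_0[of "cone_arg c R z \<tau> x"]
    by (cases "1 \<le> norm (cone_arg c R z \<tau> x)") (auto simp: cone_kernel_def)
  then show ?thesis
    using assms(1,2) by (simp add: cone_arg_eq dist_norm norm_minus_commute divide_simps)
qed

text \<open>A point of the support is \<open>z + \<tau> *\<^sub>R (e - z)\<close> with \<open>e\<close> at distance less than \<open>R\<close>, and \<open>z\<close> at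
  distance less than \<open>2 * R\<close>, from \<open>c\<close>.\<close>

lemma cone_kernel_support_norm:
  assumes "0 < \<tau>" "0 < R" "z \<in> ball c (2 * R)" "cone_kernel c R z \<tau> x \<noteq> 0"
  shows "norm (x - z) \<le> \<tau> * (3 * R)"
proof -
  have "norm (x - z - \<tau> *\<^sub>R (c - z)) < \<tau> * R"
    using cone_kernel_support[OF assms(1,2,4)]
    by (simp add: dist_norm norm_minus_commute diff_diff_eq)
  moreover have "norm (\<tau> *\<^sub>R (c - z)) \<le> \<tau> * (2 * R)"
    using assms by (simp add: dist_norm)
  ultimately show ?thesis
    using norm_triangle_sub[of "x - z" "\<tau> *\<^sub>R (c - z)"] by (simp add: algebra_simps)
qed

lemma GDERIV_cone_kernel:
  fixes x :: "real^'n::finite"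
  shows "GDERIV (cone_kernel c R z \<tau>) x :>
    (1 / (\<tau> * R)) ^ Suc CARD('n) *\<^sub>R mollifier_grad (cone_arg c R z \<tau> x)"
proof -
  have "GDERIV (\<lambda>x. mollifier (cone_arg c R z \<tau> x)) x :>
      (1 / (\<tau> * R)) *\<^sub>R mollifier_grad (cone_arg c R z \<tau> x)"
    unfolding cone_arg_affine by (rule GDERIV_affine[OF GDERIV_mollifier])
  from GDERIV_mult[OF GDERIV_const this]
  have "GDERIV (\<lambda>x. (1 / (\<tau> * R)) ^ CARD('n) * mollifier (cone_arg c R z \<tau> x)) x :>
      (1 / (\<tau> * R)) ^ CARD('n) *\<^sub>R ((1 / (\<tau> * R)) *\<^sub>R mollifier_grad (cone_arg c R z \<tau> x))
        + mollifier (cone_arg c R z \<tau> x) *\<^sub>R 0" .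
  then show ?thesis
    unfolding cone_kernel_def[abs_def] scaleR_scaleR power_Suc2 by simp
qed

lemma Ck_cone_kernel: "Ck m (cone_kernel c R z \<tau>)"
  unfolding cone_kernel_def[abs_def] cone_arg_affine
  by (rule Ck_mult[OF Ck_const Ck_affine[OF Ck_mollifier]])

lemma continuous_on_cone_kernel: "continuous_on A (cone_kernel c R z \<tau>)"
  using Ck_continuous[OF Ck_cone_kernel] continuous_on_subset by blast

lemma DERIV_cone_kernel:
  fixes x :: "real^'n::finite"
  assumes "0 < \<tau>" "0 < R"
  shows "((\<lambda>\<tau>. cone_kernel c R z \<tau> x) has_real_derivative - cone_kernel_slope c R z \<tau> x / \<tau>) (at \<tau>)"
proof -
  let ?g = "mollifier_grad (cone_arg c R z \<tau> x)"
  let ?N = "CARD('n)"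
  have p: "((\<lambda>\<tau>. 1 / (\<tau> * R)) has_real_derivative - (1 / (\<tau> * R)) / \<tau>) (at \<tau>)"
    using assms by (auto intro!: derivative_eq_intros simp: field_simps)
  have "((\<lambda>\<tau>. cone_arg c R z \<tau> x) has_derivative (\<lambda>h. (h * (- (1 / (\<tau> * R)) / \<tau>)) *\<^sub>R (x - z))) (at \<tau>)"
    unfolding cone_arg_def
    using p unfolding has_field_derivative_def
    by (intro has_derivative_eq_rhs[OF has_derivative_add_const[OF has_derivative_scaleR_left]])
       (auto simp: mult.commute)
  then have "((\<lambda>\<tau>. mollifier (cone_arg c R z \<tau> x)) has_derivative
      (\<lambda>h. ((h * (- (1 / (\<tau> * R)) / \<tau>)) *\<^sub>R (x - z)) \<bullet> ?g)) (at \<tau>)"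
    using GDERIV_mollifier unfolding gderiv_def by (rule has_derivative_compose)
  then have m: "((\<lambda>\<tau>. mollifier (cone_arg c R z \<tau> x)) has_real_derivative
      (- (1 / (\<tau> * R)) / \<tau>) * (?g \<bullet> (x - z))) (at \<tau>)"
    unfolding has_field_derivative_def
    by (rule has_derivative_eq_rhs) (auto simp: fun_eq_iff inner_commute)
  have "((\<lambda>\<tau>. cone_kernel c R z \<tau> x) has_real_derivative
      (real ?N * (- (1 / (\<tau> * R)) / \<tau>) * (1 / (\<tau> * R)) ^ (?N - 1)) * mollifier (cone_arg c R z \<tau> x)
      + ((- (1 / (\<tau> * R)) / \<tau>) * (?g \<bullet> (x - z))) * (1 / (\<tau> * R)) ^ ?N) (at \<tau>)"
    unfolding cone_kernel_def
    by (rule DERIV_cong[OF DERIV_mult[OF DERIV_power[OF p] m]]) simp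
  then show ?thesis
  proof (rule DERIV_cong)
    have alg: "(n * (- q / \<tau>) * P) * m + ((- q / \<tau>) * d) * (q * P)
        = - (q * (q * P) * d + n * (q * P * m)) / \<tau>" for n q P m d :: real
      using assms(1) by (simp add: field_simps)
    have pw: "(1 / (\<tau> * R)) ^ ?N = (1 / (\<tau> * R)) * (1 / (\<tau> * R)) ^ (?N - 1)"
      using power_Suc[of "1 / (\<tau> * R)" "?N - 1"] by simp
    show "(real ?N * (- (1 / (\<tau> * R)) / \<tau>) * (1 / (\<tau> * R)) ^ (?N - 1)) * mollifier (cone_arg c R z \<tau> x)
      + ((- (1 / (\<tau> * R)) / \<tau>) * (?g \<bullet> (x - z))) * (1 / (\<tau> * R)) ^ ?N
      = - cone_kernel_slope c R z \<tau> x / \<tau>"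
      unfolding cone_kernel_slope_def cone_kernel_def power_Suc pw by (rule alg)
  qed
qed

lemma integral_affine:
  fixes f :: "real^'n::finite \<Rightarrow> real"
  assumes "a \<noteq> 0" and [measurable]: "f \<in> borel_measurable borel"
  shows "(LINT x|lborel. f (v + a *\<^sub>R x)) = (LINT x|lborel. f x) / \<bar>a\<bar> ^ CARD('n)"
proof -
  have "(LINT x|lborel. f x)
      = integral\<^sup>L (density (distr lborel borel (\<lambda>x. v + a *\<^sub>R x)) (\<lambda>_. ennreal (\<bar>a\<bar> ^ CARD('n)))) f"
    using lborel_affine[OF assms(1), of v] by (simp add: ennreal_power)
  also have "\<dots> = (LINT x|lborel. \<bar>a\<bar> ^ CARD('n) * f (v + a *\<^sub>R x))"
    by (subst integral_density) (auto simp: integral_distr)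
  finally show ?thesis
    using assms(1) by simp
qed

text \<open>The power of \<open>1 / (\<tau> * R)\<close> in the kernel is the Jacobian of \<open>cone_arg\<close>.\<close>

lemma integral_cone_kernel:
  fixes c :: "real^'n::finite"
  assumes "0 < \<tau>" "0 < R"
  shows "(LINT x|lborel. cone_kernel c R z \<tau> x) = 1"
proof -
  define a where "a = 1 / (\<tau> * R)"
  have a: "a > 0" using assms by (simp add: a_def)
  have "(LINT x|lborel. cone_kernel c R z \<tau> x)
      = a ^ CARD('n) * (LINT x|lborel. mollifier (((1 / R) *\<^sub>R (z - c) - a *\<^sub>R z) + a *\<^sub>R x))"
    unfolding cone_kernel_def cone_arg_affine a_def by (simp add: add.commute)
  also have "\<dots> = 1"
    using a by (subst integral_affine)
      (auto simp: integral_mollifier intro!: borel_measurable_continuous_onI continuous_on_mollifier)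
  finally show ?thesis .
qed

text \<open>These test functions, one for each coordinate, are the flux of the kernel as \<open>\<tau>\<close> varies; the
  weak gradient of \<open>f\<close> is tested against them.\<close>

definition cone_field :: "real^'n::finite \<Rightarrow> real \<Rightarrow> real^'n \<Rightarrow> real \<Rightarrow> 'n \<Rightarrow> real^'n \<Rightarrow> real" where
  "cone_field c R z \<tau> i x = cone_kernel c R z \<tau> x * (x - z) $ i"

definition cone_field_grad :: "real^'n::finite \<Rightarrow> real \<Rightarrow> real^'n \<Rightarrow> real \<Rightarrow> 'n \<Rightarrow> real^'n \<Rightarrow> real^'n" where
  "cone_field_grad c R z \<tau> i x = cone_kernel c R z \<tau> x *\<^sub>R axis i 1
     + ((x - z) $ i) *\<^sub>R ((1 / (\<tau> * R)) ^ Suc CARD('n) *\<^sub>R mollifier_grad (cone_arg c R z \<tau> x))"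

lemma GDERIV_cone_field: "GDERIV (cone_field c R z \<tau> i) x :> cone_field_grad c R z \<tau> i x"
proof -
  have "GDERIV (\<lambda>x. (x - z) $ i) x :> axis i 1"
    using GDERIV_diff[OF GDERIV_component GDERIV_const[of "z $ i"]] by simp
  from GDERIV_mult[OF GDERIV_cone_kernel this] show ?thesis
    unfolding cone_field_def[abs_def] cone_field_grad_def .
qed

text \<open>This is the continuity equation for the kernel: when \<open>\<tau>\<close> grows, its mass moves along the rays
  from \<open>z\<close> with velocity \<open>(x - z) /\<^sub>R \<tau>\<close>.\<close>

lemma cone_field_divergence:
  "(\<Sum>i\<in>UNIV. cone_field_grad c R z \<tau> i x $ i) = cone_kernel_slope c R z \<tau> (x :: real^'n::finite)"
proof -
  have "(\<Sum>i\<in>UNIV. cone_field_grad c R z \<tau> i x $ i)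
      = (\<Sum>i\<in>(UNIV::'n set). cone_kernel c R z \<tau> x
          + (1 / (\<tau> * R)) ^ Suc CARD('n) * (mollifier_grad (cone_arg c R z \<tau> x) $ i * (x - z) $ i))"
    by (intro sum.cong) (simp_all add: cone_field_grad_def axis_def mult_ac)
  also have "\<dots> = cone_kernel_slope c R z \<tau> x"
    unfolding cone_kernel_slope_def inner_vec_def sum.distrib sum_distrib_left[symmetric]
    by simp
  finally show ?thesis .
qed

text \<open>The support lies in a closed ball of radius \<open>\<tau> * R\<close> whose centre is a convex combination of \<open>z\<close>
  and \<open>c\<close>; by convexity this ball stays inside the open ball of radius \<open>2 * R\<close> about \<open>c\<close>,
  however close \<open>z\<close> is to its boundary.\<close>

lemma test_function_cone_kernel_mult:
  assumes "0 < \<tau>" "\<tau> \<le> 1" "0 < R" "z \<in> ball c (2 * R)" and h: "\<And>m. Ck m h"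
  shows "test_function (ball c (2 * R)) (\<lambda>x. cone_kernel c R z \<tau> x * h x)"
proof -
  let ?S = "cball (z + \<tau> *\<^sub>R (c - z)) (\<tau> * R)"
  have "closure {x. cone_kernel c R z \<tau> x * h x \<noteq> 0} \<subseteq> ?S"
  proof (rule closure_minimal)
    show "{x. cone_kernel c R z \<tau> x * h x \<noteq> 0} \<subseteq> ?S"
      using cone_kernel_support[OF assms(1,3), of c z] ball_subset_cball by fastforce
  qed simp
  moreover have "?S \<subseteq> ball c (2 * R)"
  proof
    fix x assume "x \<in> ?S"
    then have "norm (x - (z + \<tau> *\<^sub>R (c - z))) \<le> \<tau> * R"
      by (simp add: dist_norm norm_minus_commute)
    moreover have "norm ((1 - \<tau>) *\<^sub>R (z - c)) \<le> (1 - \<tau>) * (2 * R)"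
      using assms by (auto simp: dist_norm norm_minus_commute intro!: mult_left_mono)
    moreover have "x - c = (x - (z + \<tau> *\<^sub>R (c - z))) + (1 - \<tau>) *\<^sub>R (z - c)"
      by (simp add: algebra_simps)
    ultimately have "norm (x - c) \<le> \<tau> * R + (1 - \<tau>) * (2 * R)"
      using norm_triangle_mono by metis
    also have "\<dots> < 2 * R" using assms by (simp add: algebra_simps)
    finally show "x \<in> ball c (2 * R)" by (simp add: dist_norm norm_minus_commute)
  qed
  ultimately show ?thesis
    using Ck_mult[OF Ck_cone_kernel h] unfolding test_function_def
    by (meson bounded_cball bounded_subset closed_closure compact_eq_bounded_closed order_trans)
qed

lemma test_function_cone_field:
  assumes "0 < \<tau>" "\<tau> \<le> 1" "0 < R" "z \<in> ball c (2 * R)"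
  shows "test_function (ball c (2 * R)) (cone_field c R z \<tau> i)"
proof -
  have "Ck m (\<lambda>x. x $ i + - (z $ i))" for m
    by (rule Ck_add[OF Ck_component Ck_const])
  from test_function_cone_kernel_mult[OF assms this] show ?thesis
    by (simp add: cone_field_def[abs_def])
qed

section \<open>Cone averages and weak gradients\<close>

text \<open>Differentiation under the integral by dominated convergence; the mean value theorem bounds the
  difference quotients. The derivative of \<open>K\<close> is asked for only where \<open>f\<close> does not vanish, since
  in the application it is bounded only on the ball that carries \<open>f\<close>.\<close>

lemma has_real_derivative_integral_param:
  fixes K :: "real \<Rightarrow> 'a \<Rightarrow> real" and f :: "'a \<Rightarrow> real"
  assumes f: "integrable M f" and \<delta>: "0 < \<delta>"
    and meas [measurable]: "\<And>s. s \<in> ball s0 \<delta> \<Longrightarrow> K s \<in> borel_measurable M"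
    and meas' [measurable]: "K' s0 \<in> borel_measurable M"
    and int: "\<And>s. s \<in> ball s0 \<delta> \<Longrightarrow> integrable M (\<lambda>x. K s x * f x)"
    and der: "\<And>s x. s \<in> ball s0 \<delta> \<Longrightarrow> f x \<noteq> 0 \<Longrightarrow> ((\<lambda>s. K s x) has_real_derivative K' s x) (at s)"
    and bound: "\<And>s x. s \<in> ball s0 \<delta> \<Longrightarrow> f x \<noteq> 0 \<Longrightarrow> \<bar>K' s x\<bar> \<le> C"
  shows "((\<lambda>s. LINT x|M. K s x * f x) has_real_derivative (LINT x|M. K' s0 x * f x)) (at s0)"
proof -
  let ?F = "\<lambda>s. LINT x|M. K s x * f x"
  have f_meas [measurable]: "f \<in> borel_measurable M" using f by auto
  have s0: "s0 \<in> ball s0 \<delta>" using \<delta> by simp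
  have "((\<lambda>s. (?F s - ?F s0) / (s - s0)) \<longlongrightarrow> (LINT x|M. K' s0 x * f x)) (at s0 within ball s0 \<delta>)"
    unfolding tendsto_at_iff_sequentially comp_def
  proof (intro allI impI)
    fix X :: "nat \<Rightarrow> real"
    assume X: "\<forall>i. X i \<in> ball s0 \<delta> - {s0}" and lim: "X \<longlonglongrightarrow> s0"
    have "(\<lambda>i. LINT x|M. (K (X i) x - K s0 x) / (X i - s0) * f x) \<longlonglongrightarrow> (LINT x|M. K' s0 x * f x)"
    proof (rule integral_dominated_convergence)
      show "integrable M (\<lambda>x. C * \<bar>f x\<bar>)" using f by simp
      show "(\<lambda>x. K' s0 x * f x) \<in> borel_measurable M" by measurable
      show "(\<lambda>x. (K (X i) x - K s0 x) / (X i - s0) * f x) \<in> borel_measurable M" for i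
      proof -
        have [measurable]: "K (X i) \<in> borel_measurable M" "K s0 \<in> borel_measurable M"
          using X meas s0 by auto
        show ?thesis by measurable
      qed
      show "AE x in M. (\<lambda>i. (K (X i) x - K s0 x) / (X i - s0) * f x) \<longlonglongrightarrow> K' s0 x * f x"
      proof (rule AE_I2)
        fix x
        show "(\<lambda>i. (K (X i) x - K s0 x) / (X i - s0) * f x) \<longlonglongrightarrow> K' s0 x * f x"
        proof (cases "f x = 0")
          case False
          from der[OF s0 this] have "((\<lambda>s. (K s x - K s0 x) / (s - s0)) \<longlongrightarrow> K' s0 x) (at s0)"
            by (simp add: has_field_derivative_iff)
          then have "(\<lambda>i. (K (X i) x - K s0 x) / (X i - s0)) \<longlonglongrightarrow> K' s0 x"
            unfolding tendsto_at_iff_sequentially comp_def using X lim by auto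
          then show ?thesis by (intro tendsto_mult tendsto_const)
        qed simp
      qed
      show "AE x in M. norm ((K (X i) x - K s0 x) / (X i - s0) * f x) \<le> C * \<bar>f x\<bar>" for i
      proof (rule AE_I2)
        fix x
        show "norm ((K (X i) x - K s0 x) / (X i - s0) * f x) \<le> C * \<bar>f x\<bar>"
        proof (cases "f x = 0")
          case False
          have "norm (K (X i) x - K s0 x) \<le> C * norm (X i - s0)"
          proof (rule field_differentiable_bound[OF convex_ball, of s0 \<delta>])
            show "((\<lambda>s. K s x) has_real_derivative K' s x) (at s within ball s0 \<delta>)"
              if "s \<in> ball s0 \<delta>" for s
              using der[OF that False] has_field_derivative_at_within by blast
          qed (use bound[OF _ False] X s0 in auto)
          moreover have "X i \<noteq> s0" using X by auto
          ultimately have "\<bar>K (X i) x - K s0 x\<bar> / \<bar>X i - s0\<bar> \<le> C"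
            by (simp add: pos_divide_le_eq)
          then have "\<bar>K (X i) x - K s0 x\<bar> / \<bar>X i - s0\<bar> * \<bar>f x\<bar> \<le> C * \<bar>f x\<bar>"
            by (intro mult_right_mono) auto
          then show ?thesis by (simp only: real_norm_def abs_mult abs_divide)
        qed simp
      qed
    qed
    moreover have "(LINT x|M. (K (X i) x - K s0 x) / (X i - s0) * f x) = (?F (X i) - ?F s0) / (X i - s0)" for i
    proof -
      have "(LINT x|M. (K (X i) x - K s0 x) / (X i - s0) * f x)
          = (LINT x|M. (K (X i) x * f x - K s0 x * f x) / (X i - s0))"
        by (simp add: left_diff_distrib)
      also have "\<dots> = (?F (X i) - ?F s0) / (X i - s0)"
        using int[of "X i"] int[OF s0] X
        by (simp del: left_diff_distrib add: Bochner_Integration.integral_diff)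
      finally show ?thesis .
    qed
    ultimately show "(\<lambda>i. (?F (X i) - ?F s0) / (X i - s0)) \<longlonglongrightarrow> (LINT x|M. K' s0 x * f x)"
      by (simp only:)
  qed
  then show ?thesis
    using s0 by (simp add: has_field_derivative_iff at_within_open[OF s0 open_ball])
qed

lemma integrable_continuous_mult:
  fixes f h :: "real^'n::finite \<Rightarrow> real"
  assumes f: "integrable lborel f" "\<And>x. x \<notin> ball c \<rho> \<Longrightarrow> f x = 0" and h: "continuous_on UNIV h"
  shows "integrable lborel (\<lambda>x. h x * f x)"
proof -
  have "compact (h ` cball c \<rho>)"
    using h by (intro compact_continuous_image) (auto intro: continuous_on_subset)
  then obtain C where C: "\<And>x. x \<in> cball c \<rho> \<Longrightarrow> \<bar>h x\<bar> \<le> C"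
    by (force dest!: compact_imp_bounded simp: bounded_iff)
  have [measurable]: "h \<in> borel_measurable borel"
    by (rule borel_measurable_continuous_onI[OF h])
  show ?thesis
  proof (rule Bochner_Integration.integrable_bound)
    show "integrable lborel (\<lambda>x. C * f x)" using f by simp
    show "(\<lambda>x. h x * f x) \<in> borel_measurable lborel"
      using f by measurable
    show "AE x in lborel. norm (h x * f x) \<le> norm (C * f x)"
    proof (rule AE_I2)
      fix x
      show "norm (h x * f x) \<le> norm (C * f x)"
        using C[of x] f(2)[of x] by (cases "x \<in> ball c \<rho>") (auto simp: abs_mult intro!: mult_right_mono)
    qed
  qed
qed

text \<open>Weak gradients of Borel functions that vanish outside a ball. In this form all integrals are over
  \<open>lborel\<close>, so that Fubini's theorem and affine substitutions apply directly.\<close>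

definition weak_gradient_ball ::
    "real^'n::finite \<Rightarrow> real \<Rightarrow> (real^'n \<Rightarrow> real) \<Rightarrow> (real^'n \<Rightarrow> real^'n) \<Rightarrow> bool" where
  "weak_gradient_ball c \<rho> f g \<longleftrightarrow>
     integrable lborel f \<and> integrable lborel g \<and> (\<forall>x. x \<notin> ball c \<rho> \<longrightarrow> f x = 0 \<and> g x = 0) \<and>
     (\<forall>\<phi> \<phi>'. test_function (ball c \<rho>) \<phi> \<and> (\<forall>x. GDERIV \<phi> x :> \<phi>' x) \<longrightarrow>
        (\<forall>i. (LINT x|lborel. \<phi>' x $ i * f x) = - (LINT x|lborel. \<phi> x * g x $ i)))"

lemma weak_gradient_ballD:
  assumes "weak_gradient_ball c \<rho> f g" "test_function (ball c \<rho>) \<phi>" "\<And>x. GDERIV \<phi> x :> \<phi>' x"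
  shows "(LINT x|lborel. \<phi>' x $ i * f x) = - (LINT x|lborel. \<phi> x * g x $ i)"
  using assms unfolding weak_gradient_ball_def by blast

definition cone_average :: "real^'n::finite \<Rightarrow> real \<Rightarrow> (real^'n \<Rightarrow> real) \<Rightarrow> real^'n \<Rightarrow> real \<Rightarrow> real" where
  "cone_average c R f z \<tau> = (LINT x|lborel. cone_kernel c R z \<tau> x * f x)"

lemma continuous_on_cone_arg: "continuous_on A (cone_arg c R z \<tau>)"
  unfolding cone_arg_def by (intro continuous_intros)

lemma continuous_on_cone_field_grad:
  "continuous_on UNIV (\<lambda>x. cone_field_grad c R z \<tau> i x $ j)"
  unfolding cone_field_grad_def
  by (intro continuous_intros continuous_on_cone_kernel
      continuous_on_compose2[OF continuous_on_mollifier_grad continuous_on_cone_arg]) auto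

lemma continuous_on_cone_kernel_slope: "continuous_on UNIV (cone_kernel_slope c R z \<tau>)"
  unfolding cone_field_divergence[symmetric, abs_def]
  by (intro continuous_on_sum continuous_on_cone_field_grad)

text \<open>The dominating constant for the differentiation of cone averages.\<close>

lemma cone_kernel_slope_bounded:
  fixes c :: "real^'n::finite"
  assumes "0 < \<sigma>" "0 < R" "z \<in> ball c (2 * R)"
  obtains C where "\<And>\<tau> x. \<sigma> \<le> \<tau> \<Longrightarrow> x \<in> ball c (2 * R) \<Longrightarrow> \<bar>- cone_kernel_slope c R z \<tau> x / \<tau>\<bar> \<le> C"
proof -
  let ?N = "CARD('n)" and ?M = "mollifier_max TYPE('n)" and ?q = "1 / (\<sigma> * R)"
  define C where "C = (?q ^ Suc ?N * ((4 * ?M) * (4 * R)) + real ?N * (?q ^ ?N * ?M)) / \<sigma>"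
  have M: "0 < ?M" by (rule mollifier_max_pos)
  have "\<bar>- cone_kernel_slope c R z \<tau> x / \<tau>\<bar> \<le> C" if "\<sigma> \<le> \<tau>" "x \<in> ball c (2 * R)" for \<tau> x
  proof -
    let ?p = "1 / (\<tau> * R)"
    have \<tau>: "0 < \<tau>" using that assms by simp
    have p: "0 \<le> ?p" "?p \<le> ?q" using that assms \<tau> by (auto intro!: frac_le mult_right_mono)
    have q: "0 \<le> ?q" using assms by simp
    have "norm (x - z) \<le> dist x c + dist c z"
      using dist_triangle[of x z c] by (simp add: dist_norm)
    then have "norm (x - z) \<le> 4 * R"
      using that(2) assms(3) by (simp add: dist_commute)
    then have "\<bar>mollifier_grad (cone_arg c R z \<tau> x) \<bullet> (x - z)\<bar> \<le> (4 * ?M) * (4 * R)"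
      using M by (intro order_trans[OF Cauchy_Schwarz_ineq2] mult_mono norm_mollifier_grad_le) auto
    then have 1: "?p ^ Suc ?N * \<bar>mollifier_grad (cone_arg c R z \<tau> x) \<bullet> (x - z)\<bar>
        \<le> ?q ^ Suc ?N * ((4 * ?M) * (4 * R))"
      using p by (intro mult_mono power_mono zero_le_power q) auto
    have "cone_kernel c R z \<tau> x \<le> ?p ^ ?N * ?M"
      using cone_kernel_le[OF \<tau> assms(2)] by blast
    also have "\<dots> \<le> ?q ^ ?N * ?M"
      using p M by (intro mult_right_mono power_mono) auto
    finally have 2: "real ?N * cone_kernel c R z \<tau> x \<le> real ?N * (?q ^ ?N * ?M)"
      by (intro mult_left_mono) auto
    have "\<bar>cone_kernel_slope c R z \<tau> x\<bar>
        \<le> ?p ^ Suc ?N * \<bar>mollifier_grad (cone_arg c R z \<tau> x) \<bullet> (x - z)\<bar> + real ?N * cone_kernel c R z \<tau> x"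
      using cone_kernel_nonneg[OF \<tau> assms(2), of c z x] p(1)
      unfolding cone_kernel_slope_def
      by (intro order_trans[OF abs_triangle_ineq]) (simp add: abs_mult del: power_Suc)
    also have "\<dots> \<le> ?q ^ Suc ?N * ((4 * ?M) * (4 * R)) + real ?N * (?q ^ ?N * ?M)"
      using 1 2 by (rule add_mono)
    finally have "\<bar>cone_kernel_slope c R z \<tau> x\<bar> / \<tau> \<le> C"
      unfolding C_def using assms that by (intro frac_le) auto
    then show ?thesis using \<tau> by simp
  qed
  then show ?thesis by (rule that)
qed

text \<open>The derivative of the kernel in \<open>\<tau>\<close> is a divergence of test functions, so the definition of the
  weak gradient moves it from the kernel to \<open>g\<close>.\<close>

lemma DERIV_cone_average:
  fixes c :: "real^'n::finite"
  assumes w: "weak_gradient_ball c (2 * R) f g" and R: "0 < R" and z: "z \<in> ball c (2 * R)"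
    and \<tau>: "0 < \<tau>" "\<tau> \<le> 1"
  shows "(cone_average c R f z has_real_derivative
      (LINT x|lborel. cone_kernel c R z \<tau> x * (g x \<bullet> (x - z))) / \<tau>) (at \<tau>)"
proof -
  have f: "integrable lborel f" "\<And>x. x \<notin> ball c (2 * R) \<Longrightarrow> f x = 0"
    and g: "integrable lborel g" "\<And>x. x \<notin> ball c (2 * R) \<Longrightarrow> g x = 0"
    using w by (auto simp: weak_gradient_ball_def)
  have gi: "integrable lborel (\<lambda>x. g x $ i)" for i
    using integrable_inner_left[OF g(1), of "axis i 1"] by (simp add: inner_axis)
  obtain C where C: "\<And>s x. \<tau> / 2 \<le> s \<Longrightarrow> x \<in> ball c (2 * R) \<Longrightarrow> \<bar>- cone_kernel_slope c R z s x / s\<bar> \<le> C"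
    using cone_kernel_slope_bounded[of "\<tau> / 2" R z c] \<tau> R z by auto
  have s: "\<tau> / 2 \<le> s" "0 < s" if "s \<in> ball \<tau> (\<tau> / 2)" for s
    using that by (auto simp: dist_real_def abs_real_def split: if_splits)
  have "((\<lambda>s. LINT x|lborel. cone_kernel c R z s x * f x) has_real_derivative
      (LINT x|lborel. (- cone_kernel_slope c R z \<tau> x / \<tau>) * f x)) (at \<tau>)"
  proof (rule has_real_derivative_integral_param[where \<delta> = "\<tau> / 2" and C = C])
    show "(\<lambda>x. - cone_kernel_slope c R z \<tau> x / \<tau>) \<in> borel_measurable lborel"
      using borel_measurable_continuous_onI[OF continuous_on_cone_kernel_slope] by measurable
    show "cone_kernel c R z s \<in> borel_measurable lborel" for s
      using borel_measurable_continuous_onI[OF continuous_on_cone_kernel] by measurable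
    show "integrable lborel (\<lambda>x. cone_kernel c R z s x * f x)" for s
      by (rule integrable_continuous_mult[OF f continuous_on_cone_kernel])
    show "((\<lambda>s. cone_kernel c R z s x) has_real_derivative - cone_kernel_slope c R z s x / s) (at s)"
      if "s \<in> ball \<tau> (\<tau> / 2)" for s x
      by (rule DERIV_cone_kernel[OF s(2)[OF that] R])
    show "\<bar>- cone_kernel_slope c R z s x / s\<bar> \<le> C"
      if "s \<in> ball \<tau> (\<tau> / 2)" "f x \<noteq> 0" for s x
      using C[OF s(1)[OF that(1)]] f(2)[of x] that(2) by blast
  qed (use f \<tau> in auto)
  also have "(LINT x|lborel. (- cone_kernel_slope c R z \<tau> x / \<tau>) * f x)
      = - (LINT x|lborel. (\<Sum>i\<in>UNIV. cone_field_grad c R z \<tau> i x $ i * f x)) / \<tau>"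
    by (simp add: cone_field_divergence[symmetric] sum_distrib_right)
  also have "(LINT x|lborel. (\<Sum>i\<in>UNIV. cone_field_grad c R z \<tau> i x $ i * f x))
      = (\<Sum>i\<in>UNIV. LINT x|lborel. cone_field_grad c R z \<tau> i x $ i * f x)"
    by (intro Bochner_Integration.integral_sum integrable_continuous_mult[OF f continuous_on_cone_field_grad])
  also have "\<dots> = (\<Sum>i\<in>UNIV. - (LINT x|lborel. cone_field c R z \<tau> i x * g x $ i))"
  proof (intro sum.cong refl)
    fix i
    have "test_function (ball c (2 * R)) (cone_field c R z \<tau> i) \<and>
        (\<forall>x. GDERIV (cone_field c R z \<tau> i) x :> cone_field_grad c R z \<tau> i x)"
      using test_function_cone_field[OF \<tau> R z] GDERIV_cone_field by blast
    then show "(LINT x|lborel. cone_field_grad c R z \<tau> i x $ i * f x)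
        = - (LINT x|lborel. cone_field c R z \<tau> i x * g x $ i)"
      using w unfolding weak_gradient_ball_def by blast
  qed
  also have "\<dots> = - (LINT x|lborel. (\<Sum>i\<in>UNIV. cone_field c R z \<tau> i x * g x $ i))"
  proof -
    have "integrable lborel (\<lambda>x. cone_field c R z \<tau> i x * g x $ i)" for i
    proof (rule integrable_continuous_mult[OF gi, of c "2 * R"])
      show "continuous_on UNIV (cone_field c R z \<tau> i)"
        unfolding cone_field_def[abs_def] by (intro continuous_intros continuous_on_cone_kernel)
    qed (use g in auto)
    then show ?thesis by (simp add: Bochner_Integration.integral_sum sum_negf)
  qed
  also have "(\<lambda>x. \<Sum>i\<in>UNIV. cone_field c R z \<tau> i x * g x $ i)
      = (\<lambda>x. cone_kernel c R z \<tau> x * (g x \<bullet> (x - z)))"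
    by (simp add: cone_field_def inner_vec_def sum_distrib_left mult_ac)
  finally show ?thesis
    by (simp add: cone_average_def[abs_def])
qed

text \<open>An elementary form of Young's inequality. Integrated against a probability density, with \<open>l\<close>
  chosen so that the two terms balance, it gives Hoelder's inequality up to the factor \<open>2\<close>.\<close>

lemma powr_young_le:
  fixes v l t :: real
  assumes "0 \<le> v" "0 < l" "1 \<le> t"
  shows "v \<le> l powr (1 - t) * v powr t + l"
proof (cases "v \<le> l")
  case False
  then have "v = v powr (1 - t) * v powr t"
    using assms by (simp flip: powr_add)
  also have "\<dots> \<le> l powr (1 - t) * v powr t"
    using assms False by (intro mult_right_mono powr_mono2') auto
  finally show ?thesis using assms by simp
qed (simp add: add_increasing)

text \<open>On the support of the kernel \<open>norm (x - z) \<le> 3 * R * \<tau>\<close>, which cancels the division by \<open>\<tau>\<close>.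
  The rest is Hoelder's inequality for a kernel of mass \<open>1\<close> with the bound \<open>cone_kernel_le\<close>.\<close>

lemma cone_average_slope_le:
  fixes c :: "real^'n::finite"
  assumes g: "integrable lborel g" "\<And>x. x \<notin> ball c (2 * R) \<Longrightarrow> g x = 0"
    and gt: "integrable lborel (\<lambda>x. norm (g x) powr t)" "(LINT x|lborel. norm (g x) powr t) \<le> \<Gamma> powr t"
    and t: "1 \<le> t" and \<Gamma>: "0 < \<Gamma>" and R: "0 < R" and z: "z \<in> ball c (2 * R)" and \<tau>: "0 < \<tau>"
  shows "\<bar>(LINT x|lborel. cone_kernel c R z \<tau> x * (g x \<bullet> (x - z))) / \<tau>\<bar>
    \<le> 6 * R * \<Gamma> * ((1 / (\<tau> * R)) ^ CARD('n) * mollifier_max TYPE('n)) powr (1 / t)"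
proof -
  let ?k = "cone_kernel c R z \<tau>"
  define S where "S = (1 / (\<tau> * R)) ^ CARD('n) * mollifier_max TYPE('n)"
  \<comment> \<open>this choice makes \<open>l powr (1 - t) * S * \<Gamma> powr t\<close> equal to \<open>l\<close>\<close>
  define l where "l = S powr (1 / t) * \<Gamma>"
  have S: "0 < S" using \<tau> R mollifier_max_pos[where 'n='n] by (simp add: S_def)
  have l: "0 < l" using S \<Gamma> by (simp add: l_def)
  have k: "0 \<le> ?k x" "?k x \<le> S" for x
    using cone_kernel_nonneg[OF \<tau> R] cone_kernel_le[OF \<tau> R] by (auto simp: S_def)
  have [measurable]: "?k \<in> borel_measurable borel"
    by (rule borel_measurable_continuous_onI[OF continuous_on_cone_kernel])
  have [measurable]: "g \<in> borel_measurable borel" using g(1) by auto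
  have kint: "integrable lborel ?k"
    using integral_cone_kernel[OF \<tau> R, of c z] not_integrable_integral_eq by fastforce
  have ikg: "integrable lborel (\<lambda>x. ?k x * (l powr (1 - t) * norm (g x) powr t + l))"
  proof -
    have "integrable lborel (\<lambda>x. ?k x * (norm (g x) powr t))"
      by (rule integrable_continuous_mult[OF gt(1) _ continuous_on_cone_kernel]) (use g t in auto)
    then have "integrable lborel (\<lambda>x. l powr (1 - t) * (?k x * (norm (g x) powr t)) + l * ?k x)"
      using kint by (intro Bochner_Integration.integrable_add integrable_mult_right) auto
    then show ?thesis by (simp add: algebra_simps)
  qed
  have "\<bar>LINT x|lborel. ?k x * (g x \<bullet> (x - z))\<bar>
      \<le> (LINT x|lborel. \<tau> * (3 * R) * (?k x * (l powr (1 - t) * norm (g x) powr t + l)))"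
  proof (rule order_trans[OF integral_abs_bound integral_mono'])
    show "integrable lborel (\<lambda>x. \<tau> * (3 * R) * (?k x * (l powr (1 - t) * norm (g x) powr t + l)))"
      using ikg by simp
    fix x
    show "\<bar>?k x * (g x \<bullet> (x - z))\<bar> \<le> \<tau> * (3 * R) * (?k x * (l powr (1 - t) * norm (g x) powr t + l))"
    proof (cases "?k x = 0")
      case False
      have "\<bar>g x \<bullet> (x - z)\<bar> \<le> (l powr (1 - t) * norm (g x) powr t + l) * (\<tau> * (3 * R))"
        using cone_kernel_support_norm[OF \<tau> R z False] powr_young_le[OF _ l t, of "norm (g x)"] l
        by (intro order_trans[OF Cauchy_Schwarz_ineq2] mult_mono) auto
      then have "?k x * \<bar>g x \<bullet> (x - z)\<bar> \<le> ?k x * ((l powr (1 - t) * norm (g x) powr t + l) * (\<tau> * (3 * R)))"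
        using k(1)[of x] by (intro mult_left_mono) auto
      then show ?thesis using k(1)[of x] by (simp add: abs_mult mult_ac)
    qed simp
  qed (use \<tau> R l k in auto)
  also have "\<dots> = \<tau> * (3 * R) * (LINT x|lborel. l powr (1 - t) * (?k x * norm (g x) powr t) + l * ?k x)"
    by (subst integral_mult_right_zero[symmetric])
       (intro Bochner_Integration.integral_cong refl, simp only: distrib_left mult_ac)
  also have "(LINT x|lborel. l powr (1 - t) * (?k x * norm (g x) powr t) + l * ?k x)
      \<le> (LINT x|lborel. l powr (1 - t) * (S * norm (g x) powr t) + l * ?k x)"
    using k gt kint l S
    by (intro integral_mono' add_mono mult_left_mono mult_right_mono) auto
  also have "\<dots> = l powr (1 - t) * (S * (LINT x|lborel. norm (g x) powr t)) + l"
    using gt kint integral_cone_kernel[OF \<tau> R, of c z]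
    by (subst Bochner_Integration.integral_add) auto
  also have "\<dots> \<le> l powr (1 - t) * (S * \<Gamma> powr t) + l"
    using gt(2) S by (intro add_mono mult_left_mono) auto
  also have "\<dots> = 2 * l"
  proof -
    have "S * \<Gamma> powr t = l powr t"
      using S \<Gamma> t by (simp add: l_def powr_mult powr_powr)
    then show ?thesis
      using l by (simp flip: powr_add)
  qed
  finally have "\<bar>LINT x|lborel. ?k x * (g x \<bullet> (x - z))\<bar> \<le> \<tau> * (3 * R) * (2 * l)"
    using \<tau> R by (simp add: mult_left_mono)
  then show ?thesis
    using \<tau> unfolding S_def[symmetric] by (simp add: l_def pos_divide_le_eq mult_ac)
qed

text \<open>The denominator is the exponent \<open>\<alpha> = 1 - CARD('n) / t\<close>; it comes from integrating
  \<open>\<tau> powr (\<alpha> - 1)\<close>.\<close>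

definition morrey_const :: "'n::finite itself \<Rightarrow> real \<Rightarrow> real" where
  "morrey_const _ t = 6 * mollifier_max TYPE('n) powr (1 / t) / (1 - real CARD('n) / t)"

text \<open>The slope of the average is at most a multiple of \<open>\<tau> powr (\<alpha> - 1)\<close>. Because \<open>t\<close> exceeds the
  dimension, \<open>\<alpha>\<close> is positive, and this bound has the primitive \<open>\<tau> powr \<alpha> / \<alpha>\<close>, which is finite
  at \<open>\<tau> = 0\<close>.\<close>

lemma cone_average_diff_le:
  fixes c :: "real^'n::finite"
  assumes w: "weak_gradient_ball c (2 * R) f g"
    and gt: "integrable lborel (\<lambda>x. norm (g x) powr t)" "(LINT x|lborel. norm (g x) powr t) \<le> \<Gamma> powr t"
    and t: "real CARD('n) < t" and \<Gamma>: "0 < \<Gamma>" and R: "0 < R" and z: "z \<in> ball c (2 * R)"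
    and \<sigma>: "0 < \<sigma>" "\<sigma> \<le> \<tau>" "\<tau> \<le> 1"
  defines "\<alpha> \<equiv> 1 - real CARD('n) / t"
  shows "\<bar>cone_average c R f z \<tau> - cone_average c R f z \<sigma>\<bar>
    \<le> morrey_const TYPE('n) t * R powr \<alpha> * \<Gamma> * (\<tau> powr \<alpha> - \<sigma> powr \<alpha>)"
proof -
  let ?F = "cone_average c R f z" and ?M = "mollifier_max TYPE('n)"
  define F' where "F' s = (LINT x|lborel. cone_kernel c R z s x * (g x \<bullet> (x - z))) / s" for s
  define D where "D = 6 * ?M powr (1 / t) * R powr \<alpha> * \<Gamma>"
  have M: "0 < ?M" by (rule mollifier_max_pos)
  have t1: "1 \<le> t" "0 < t"
    using t one_le_card_finite[where 'a='n] by linarith+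
  have \<alpha>: "0 < \<alpha>" using t t1 by (simp add: \<alpha>_def)
  have g: "integrable lborel g" "\<And>x. x \<notin> ball c (2 * R) \<Longrightarrow> g x = 0"
    using w by (auto simp: weak_gradient_ball_def)
  have F: "(?F has_real_derivative F' s) (at s)" if "0 < s" "s \<le> 1" for s
    unfolding F'_def by (rule DERIV_cone_average[OF w R z that])
  have F'_le: "\<bar>F' s\<bar> \<le> D * s powr (\<alpha> - 1)" if s: "0 < s" for s
  proof -
    have "\<bar>F' s\<bar> \<le> 6 * R * \<Gamma> * ((1 / (s * R)) ^ CARD('n) * ?M) powr (1 / t)"
      unfolding F'_def by (rule cone_average_slope_le[OF g gt t1(1) \<Gamma> R z s])
    also have "((1 / (s * R)) ^ CARD('n) * ?M) powr (1 / t)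
        = ?M powr (1 / t) * (s powr (\<alpha> - 1) * R powr (\<alpha> - 1))"
    proof -
      have "(1 / (s * R)) ^ CARD('n) = (s * R) powr - real CARD('n)"
        using s R by (simp add: powr_minus powr_realpow power_mult_distrib power_inverse divide_inverse)
      then have "((1 / (s * R)) ^ CARD('n)) powr (1 / t) = (s * R) powr (\<alpha> - 1)"
        by (simp add: powr_powr \<alpha>_def)
      then show ?thesis
        using s R M by (simp add: powr_mult)
    qed
    also have "6 * R * \<Gamma> * (?M powr (1 / t) * (s powr (\<alpha> - 1) * R powr (\<alpha> - 1)))
        = 6 * ?M powr (1 / t) * (R powr 1 * R powr (\<alpha> - 1)) * \<Gamma> * s powr (\<alpha> - 1)"
      using R by simp
    also have "R powr 1 * R powr (\<alpha> - 1) = R powr \<alpha>"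
      using powr_add[of R 1 "\<alpha> - 1"] by simp
    finally show ?thesis by (simp add: D_def)
  qed
  have pw: "((\<lambda>s. D / \<alpha> * s powr \<alpha>) has_real_derivative D * s powr (\<alpha> - 1)) (at s)" if "0 < s" for s
    using that \<alpha> by (auto intro!: derivative_eq_intros)
  \<comment> \<open>adding the average to the primitive of the bound, or subtracting it, gives a nondecreasing function\<close>
  have "D / \<alpha> * \<sigma> powr \<alpha> + ?F \<sigma> \<le> D / \<alpha> * \<tau> powr \<alpha> + ?F \<tau>"
  proof (rule DERIV_nonneg_imp_nondecreasing[OF \<sigma>(2)])
    fix s assume s: "\<sigma> \<le> s" "s \<le> \<tau>"
    then have "0 < s" "s \<le> 1" using \<sigma> by auto
    then show "\<exists>y. ((\<lambda>s. D / \<alpha> * s powr \<alpha> + ?F s) has_real_derivative y) (at s) \<and> 0 \<le> y"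
      using DERIV_add[OF pw F] F'_le[of s] by (intro exI[of _ "D * s powr (\<alpha> - 1) + F' s"]) auto
  qed
  moreover have "D / \<alpha> * \<sigma> powr \<alpha> - ?F \<sigma> \<le> D / \<alpha> * \<tau> powr \<alpha> - ?F \<tau>"
  proof (rule DERIV_nonneg_imp_nondecreasing[OF \<sigma>(2)])
    fix s assume s: "\<sigma> \<le> s" "s \<le> \<tau>"
    then have "0 < s" "s \<le> 1" using \<sigma> by auto
    then show "\<exists>y. ((\<lambda>s. D / \<alpha> * s powr \<alpha> - ?F s) has_real_derivative y) (at s) \<and> 0 \<le> y"
      using DERIV_diff[OF pw F] F'_le[of s] by (intro exI[of _ "D * s powr (\<alpha> - 1) - F' s"]) auto
  qed
  ultimately have "\<bar>?F \<tau> - ?F \<sigma>\<bar> \<le> D / \<alpha> * (\<tau> powr \<alpha> - \<sigma> powr \<alpha>)"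
    by (simp add: abs_le_iff right_diff_distrib)
  moreover have "D / \<alpha> = morrey_const TYPE('n) t * R powr \<alpha> * \<Gamma>"
    by (simp add: D_def morrey_const_def \<alpha>_def)
  ultimately show ?thesis by simp
qed

section \<open>Limits of cone averages\<close>

lemma continuous_on_cone_average:
  fixes c :: "real^'n::finite"
  assumes f: "integrable lborel f" and "0 < \<tau>" "0 < R"
  shows "continuous_on A (\<lambda>z. cone_average c R f z \<tau>)"
  unfolding continuous_on_sequentially comp_def cone_average_def
proof (intro allI ballI impI)
  fix X a
  assume "(\<forall>n. X n \<in> A) \<and> X \<longlonglongrightarrow> a"
  then have X: "X \<longlonglongrightarrow> a" by blast
  let ?C = "(1 / (\<tau> * R)) ^ CARD('n) * mollifier_max TYPE('n)"
  have meas: "(\<lambda>x. cone_kernel c R z \<tau> x * f x) \<in> borel_measurable lborel" for z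
    using borel_measurable_continuous_onI[OF continuous_on_cone_kernel] f
    by (intro borel_measurable_times) auto
  show "(\<lambda>n. LINT x|lborel. cone_kernel c R (X n) \<tau> x * f x) \<longlonglongrightarrow> (LINT x|lborel. cone_kernel c R a \<tau> x * f x)"
  proof (rule integral_dominated_convergence)
    show "integrable lborel (\<lambda>x. ?C * \<bar>f x\<bar>)" using f by simp
    show "AE x in lborel. (\<lambda>n. cone_kernel c R (X n) \<tau> x * f x) \<longlonglongrightarrow> cone_kernel c R a \<tau> x * f x"
    proof (rule AE_I2)
      fix x
      have "(\<lambda>n. cone_arg c R (X n) \<tau> x) \<longlonglongrightarrow> cone_arg c R a \<tau> x"
        unfolding cone_arg_def by (intro tendsto_intros X)
      then have "(\<lambda>n. mollifier (cone_arg c R (X n) \<tau> x)) \<longlonglongrightarrow> mollifier (cone_arg c R a \<tau> x)"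
        using continuous_on_mollifier[of UNIV]
        by (auto simp: continuous_on_eq_continuous_at intro: isCont_tendsto_compose)
      then show "(\<lambda>n. cone_kernel c R (X n) \<tau> x * f x) \<longlonglongrightarrow> cone_kernel c R a \<tau> x * f x"
        unfolding cone_kernel_def by (intro tendsto_mult tendsto_const)
    qed
    show "AE x in lborel. norm (cone_kernel c R (X n) \<tau> x * f x) \<le> ?C * \<bar>f x\<bar>" for n
      using cone_kernel_nonneg[OF assms(2,3), of c] cone_kernel_le[OF assms(2,3), of c]
      by (intro AE_I2) (auto simp: abs_mult intro!: mult_right_mono)
  qed (rule meas)+
qed

text \<open>At \<open>\<tau> = 1\<close> the kernel no longer depends on the vertex. The averages from all vertices therefore
  start at one common value.\<close>

lemma cone_average_1: "cone_average c R f z 1 = cone_average c R f z' 1"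
proof -
  have "cone_arg c R z 1 = cone_arg c R z' 1"
    by (simp add: cone_arg_def fun_eq_iff algebra_simps)
  then show ?thesis by (simp add: cone_average_def cone_kernel_def)
qed

text \<open>As a function of the vertex the argument of the mollifier is again affine, now with factor
  \<open>- (1 - \<sigma>) / (\<sigma> * R)\<close>.\<close>

lemma integral_cone_kernel_vertex:
  fixes c :: "real^'n::finite"
  assumes \<sigma>: "0 < \<sigma>" "\<sigma> < 1" and R: "0 < R" and [measurable]: "E \<in> sets borel"
  shows "(LINT z|lborel. indicator E z * cone_kernel c R z \<sigma> x)
    = (1 / (1 - \<sigma>)) ^ CARD('n)
      * (LINT w|lborel. indicator E ((1 / (1 - \<sigma>)) *\<^sub>R (x - \<sigma> *\<^sub>R c - (\<sigma> * R) *\<^sub>R w)) * mollifier w)"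
proof -
  have [measurable]: "(mollifier :: real^'n \<Rightarrow> real) \<in> borel_measurable borel"
    by (rule borel_measurable_continuous_onI[OF continuous_on_mollifier])
  define a where "a = - ((1 - \<sigma>) / (\<sigma> * R))"
  define v where "v = (1 / (\<sigma> * R)) *\<^sub>R (x - \<sigma> *\<^sub>R c)"
  define \<psi> where "\<psi> w = indicator E ((1 / (1 - \<sigma>)) *\<^sub>R (x - \<sigma> *\<^sub>R c - (\<sigma> * R) *\<^sub>R w)) * mollifier w" for w
  have a: "a \<noteq> 0" using \<sigma> R by (simp add: a_def)
  have arg: "cone_arg c R z \<sigma> x = v + a *\<^sub>R z" for z
    using \<sigma> R by (simp add: cone_arg_def v_def a_def algebra_simps diff_divide_distrib)
  have vertex: "(1 / (1 - \<sigma>)) *\<^sub>R (x - \<sigma> *\<^sub>R c - (\<sigma> * R) *\<^sub>R (v + a *\<^sub>R z)) = z" for z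
  proof -
    have "(\<sigma> * R) *\<^sub>R (v + a *\<^sub>R z) = (x - \<sigma> *\<^sub>R c) - (1 - \<sigma>) *\<^sub>R z"
      using \<sigma> R by (simp add: scaleR_add_right scaleR_diff_right v_def a_def)
    then show ?thesis using \<sigma> by simp
  qed
  have "(LINT z|lborel. indicator E z * cone_kernel c R z \<sigma> x)
      = (1 / (\<sigma> * R)) ^ CARD('n) * (LINT z|lborel. \<psi> (v + a *\<^sub>R z))"
    unfolding \<psi>_def vertex cone_kernel_def arg
    by (subst integral_mult_right_zero[symmetric])
       (intro Bochner_Integration.integral_cong refl, simp only: mult.left_commute)
  also have "\<dots> = (1 / (\<sigma> * R)) ^ CARD('n) * ((LINT w|lborel. \<psi> w) / \<bar>a\<bar> ^ CARD('n))"
    by (subst integral_affine[OF a]) (auto simp: \<psi>_def[abs_def])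
  also have "(1 / (\<sigma> * R)) ^ CARD('n) * ((LINT w|lborel. \<psi> w) / \<bar>a\<bar> ^ CARD('n))
      = ((1 / (\<sigma> * R)) / \<bar>a\<bar>) ^ CARD('n) * (LINT w|lborel. \<psi> w)"
    by (simp only: power_divide times_divide_eq_left times_divide_eq_right)
  also have "(1 / (\<sigma> * R)) / \<bar>a\<bar> = 1 / (1 - \<sigma>)"
    using \<sigma> R by (simp add: a_def)
  finally show ?thesis unfolding \<psi>_def .
qed

lemma cone_kernel_vertex_mass:
  fixes c :: "real^'n::finite"
  assumes \<sigma>: "0 < \<sigma>" "\<sigma> \<le> 1 / 2" and R: "0 < R" and [measurable]: "E \<in> sets borel"
  shows "\<bar>LINT z|lborel. indicator E z * cone_kernel c R z \<sigma> x\<bar> \<le> 2 ^ CARD('n)"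
proof -
  let ?I = "LINT w|lborel. indicator E ((1 / (1 - \<sigma>)) *\<^sub>R (x - \<sigma> *\<^sub>R c - (\<sigma> * R) *\<^sub>R w)) * mollifier w"
  have "0 \<le> ?I" by (intro integral_nonneg_AE AE_I2) (simp add: mollifier_nonneg)
  moreover have "?I \<le> (LINT w|lborel. mollifier (w :: real^'n))"
    using integrable_mollifier mollifier_nonneg
    by (intro integral_mono') (auto simp: indicator_def)
  ultimately have I: "0 \<le> ?I" "?I \<le> 1" by (auto simp: integral_mollifier)
  have q: "0 \<le> 1 / (1 - \<sigma>)" "1 / (1 - \<sigma>) \<le> 2" using \<sigma> by (auto simp: divide_simps)
  have "(1 / (1 - \<sigma>)) ^ CARD('n) * ?I \<le> 2 ^ CARD('n) * 1"
    using q I by (intro mult_mono power_mono) auto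
  moreover have "0 \<le> (1 / (1 - \<sigma>)) ^ CARD('n) * ?I"
    using q I by (intro mult_nonneg_nonneg) auto
  moreover have "\<sigma> < 1" using \<sigma> by simp
  ultimately show ?thesis
    using \<sigma> R by (subst integral_cone_kernel_vertex) auto
qed

text \<open>For small \<open>\<sigma>\<close> the point in the indicator of \<open>integral_cone_kernel_vertex\<close> is close to \<open>x\<close>. Off the
  frontier of \<open>E\<close> it lies in \<open>E\<close> if and only if \<open>x\<close> does.\<close>

lemma cone_kernel_vertex_tendsto:
  fixes c :: "real^'n::finite" and \<sigma> :: "nat \<Rightarrow> real"
  assumes \<sigma>: "\<And>i. 0 < \<sigma> i" "\<And>i. \<sigma> i < 1" "\<sigma> \<longlonglongrightarrow> 0" and R: "0 < R"
    and E [measurable]: "E \<in> sets borel" and x: "x \<notin> frontier E"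
  shows "(\<lambda>i. LINT z|lborel. indicator E z * cone_kernel c R z (\<sigma> i) x) \<longlonglongrightarrow> indicator E x"
proof -
  have [measurable]: "(mollifier :: real^'n \<Rightarrow> real) \<in> borel_measurable borel"
    by (rule borel_measurable_continuous_onI[OF continuous_on_mollifier])
  let ?Z = "\<lambda>i w. (1 / (1 - \<sigma> i)) *\<^sub>R (x - \<sigma> i *\<^sub>R c - (\<sigma> i * R) *\<^sub>R w)"
  have "(\<lambda>i. LINT w|lborel. indicator E (?Z i w) * mollifier w)
      \<longlonglongrightarrow> (LINT w|lborel. indicator E x * mollifier (w :: real^'n))"
  proof (rule integral_dominated_convergence)
    show "integrable lborel (mollifier :: real^'n \<Rightarrow> real)" by (rule integrable_mollifier)
    show "AE w in lborel. (\<lambda>i. indicator E (?Z i w) * mollifier w) \<longlonglongrightarrow> indicator E x * mollifier w"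
    proof (rule AE_I2)
      fix w :: "real^'n"
      have "(\<lambda>i. ?Z i w) \<longlonglongrightarrow> (1 / (1 - 0)) *\<^sub>R (x - 0 *\<^sub>R c - (0 * R) *\<^sub>R w)"
        by (intro tendsto_intros \<sigma>(3)) auto
      then have lim: "(\<lambda>i. ?Z i w) \<longlonglongrightarrow> x" by simp
      have "\<forall>\<^sub>F i in sequentially. indicator E (?Z i w) = (indicator E x :: real)"
      proof (cases "x \<in> interior E")
        case True
        then have "\<forall>\<^sub>F i in sequentially. ?Z i w \<in> interior E"
          using topological_tendstoD[OF lim open_interior] by blast
        then show ?thesis
          by eventually_elim (use True interior_subset in \<open>auto simp: indicator_def\<close>)
      next
        case False
        then have nx: "x \<in> - closure E" using x by (auto simp: frontier_def)
        then have "\<forall>\<^sub>F i in sequentially. ?Z i w \<in> - closure E"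
          using topological_tendstoD[OF lim open_Compl[OF closed_closure]] by blast
        then show ?thesis
          by eventually_elim (use nx closure_subset in \<open>auto simp: indicator_def\<close>)
      qed
      then have "(\<lambda>i. indicator E (?Z i w)) \<longlonglongrightarrow> (indicator E x :: real)"
        by (rule tendsto_eventually)
      then show "(\<lambda>i. indicator E (?Z i w) * mollifier w) \<longlonglongrightarrow> indicator E x * mollifier w"
        by (intro tendsto_intros)
    qed
    show "AE w in lborel. norm (indicator E (?Z i w) * mollifier w) \<le> mollifier w" for i
      using mollifier_nonneg by (intro AE_I2) (auto simp: indicator_def)
    show "(\<lambda>w. indicator E x * mollifier (w :: real^'n)) \<in> borel_measurable lborel"
      by measurable
    have "(\<lambda>w. indicator E (q *\<^sub>R (x - s *\<^sub>R c - (s * R) *\<^sub>R w)) * mollifier w) \<in> borel_measurable lborel"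
      for q s by measurable
    then show "(\<lambda>w. indicator E (?Z i w) * mollifier w) \<in> borel_measurable lborel" for i .
  qed
  then have "(\<lambda>i. (1 / (1 - \<sigma> i)) ^ CARD('n) * (LINT w|lborel. indicator E (?Z i w) * mollifier w))
      \<longlonglongrightarrow> (1 / (1 - 0)) ^ CARD('n) * (LINT w|lborel. indicator E x * mollifier (w :: real^'n))"
    by (intro tendsto_intros \<sigma>(3)) auto
  then show ?thesis
    using \<sigma> R by (simp add: integral_cone_kernel_vertex integral_mollifier)
qed

lemma integral_cone_average_box:
  fixes c :: "real^'n::finite"
  assumes f: "integrable lborel f" and \<sigma>: "0 < \<sigma>" and R: "0 < R"
  shows "(LINT z|lborel. indicator (cbox a b) z * cone_average c R f z \<sigma>)
    = (LINT x|lborel. (LINT z|lborel. indicator (cbox a b) z * cone_kernel c R z \<sigma> x) * f x)"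
proof -
  let ?E = "cbox a b"
  let ?C = "(1 / (\<sigma> * R)) ^ CARD('n) * mollifier_max TYPE('n)"
  have [measurable]: "(mollifier :: real^'n \<Rightarrow> real) \<in> borel_measurable borel"
    by (rule borel_measurable_continuous_onI[OF continuous_on_mollifier])
  have [measurable]: "f \<in> borel_measurable borel" using f by auto
  have int: "integrable (lborel \<Otimes>\<^sub>M lborel) (\<lambda>(z, x). ?C * (indicator ?E z * f x))"
  proof (rule lborel_pair.Fubini_integrable)
    show "integrable lborel (\<lambda>z. LINT x|lborel. norm (case (z, x) of (z, x) \<Rightarrow> ?C * (indicator ?E z * f x)))"
      using integrable_real_indicator[of ?E lborel] emeasure_lborel_cbox_finite[of a b]
      by (simp add: abs_mult integrable_mult_left_iff)
    show "AE z in lborel. integrable lborel (\<lambda>x. case (z, x) of (z, x) \<Rightarrow> ?C * (indicator ?E z * f x))"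
      using f by simp
    show "(\<lambda>(z, x). ?C * (indicator ?E z * f x)) \<in> borel_measurable (lborel \<Otimes>\<^sub>M lborel)"
      by measurable
  qed
  have "integrable (lborel \<Otimes>\<^sub>M lborel) (\<lambda>(z, x). indicator ?E z * cone_kernel c R z \<sigma> x * f x)"
  proof (rule Bochner_Integration.integrable_bound[OF int])
    show "(\<lambda>(z, x). indicator ?E z * cone_kernel c R z \<sigma> x * f x) \<in> borel_measurable (lborel \<Otimes>\<^sub>M lborel)"
      unfolding cone_kernel_def cone_arg_def by measurable
    have "norm (indicator ?E z * cone_kernel c R z \<sigma> x * f x) \<le> norm (?C * (indicator ?E z * f x))" for z x
    proof -
      have "\<bar>cone_kernel c R z \<sigma> x\<bar> \<le> \<bar>?C\<bar>"
        using cone_kernel_nonneg[OF \<sigma> R, of c z x] cone_kernel_le[OF \<sigma> R, of c z x] by linarith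
      then have "\<bar>cone_kernel c R z \<sigma> x\<bar> * \<bar>indicator ?E z * f x\<bar> \<le> \<bar>?C\<bar> * \<bar>indicator ?E z * f x\<bar>"
        by (intro mult_right_mono) auto
      then show ?thesis by (simp only: real_norm_def abs_mult mult_ac)
    qed
    then show "AE p in lborel \<Otimes>\<^sub>M lborel.
        norm (case p of (z, x) \<Rightarrow> indicator ?E z * cone_kernel c R z \<sigma> x * f x)
        \<le> norm (case p of (z, x) \<Rightarrow> ?C * (indicator ?E z * f x))"
      by (intro AE_I2) auto
  qed
  from lborel_pair.Fubini_integral[OF this] show ?thesis
    unfolding cone_average_def
    by (simp only: integral_mult_left_zero[symmetric] integral_mult_right_zero[symmetric] mult.assoc)
qed

text \<open>By Lebesgue's differentiation theorem almost every value of \<open>h\<close> is the limit of its means over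
  the cubes with lowest corner \<open>x\<close>; the small ones among these cubes lie in \<open>S\<close>.\<close>

lemma eq_0_AE_if_box_integrals_0:
  fixes h :: "'a::euclidean_space \<Rightarrow> real"
  assumes h: "integrable lborel h" and S: "open S"
    and box: "\<And>a b. cbox a b \<subseteq> S \<Longrightarrow> (LINT x|lborel. indicator (cbox a b) x * h x) = 0"
  shows "AE x in lborel. x \<in> S \<longrightarrow> h x = 0"
proof -
  have int: "h integrable_on cbox a b" for a b
    using integrable_on_lborel[OF h] integrable_on_subcbox by blast
  have zero: "integral (cbox a b) h = 0" if "cbox a b \<subseteq> S" for a b
  proof -
    have "integrable lborel (\<lambda>x. indicator (cbox a b) x *\<^sub>R h x)"
      using h by (intro integrable_mult_indicator) auto
    then have "integral UNIV (\<lambda>x. indicator (cbox a b) x * h x) = 0"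
      using integral_lborel[of "\<lambda>x. indicator (cbox a b) x * h x"] box[OF that] by simp
    moreover have "(\<lambda>x. indicator (cbox a b) x * h x) = (\<lambda>x. if x \<in> cbox a b then h x else 0)"
      by (auto simp: indicator_def)
    ultimately show ?thesis
      by (simp add: integral_restrict_UNIV)
  qed
  obtain N where N: "negligible N" and lim: "\<And>x e. \<lbrakk>x \<notin> N; 0 < e\<rbrakk> \<Longrightarrow>
      \<exists>d>0. \<forall>r. 0 < r \<and> r < d \<longrightarrow> norm (integral (cbox x (x + r *\<^sub>R One)) h /\<^sub>R r ^ DIM('a) - h x) < e"
    using integrable_ccontinuous_explicit[OF int] by metis
  have "h x = 0" if x: "x \<notin> N" "x \<in> S" for x
  proof (rule ccontr)
    assume "h x \<noteq> 0"
    then obtain d where d: "d > 0" and close: "\<And>r. 0 < r \<and> r < d \<Longrightarrow>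
        norm (integral (cbox x (x + r *\<^sub>R One)) h /\<^sub>R r ^ DIM('a) - h x) < \<bar>h x\<bar>"
      using lim[OF x(1), of "\<bar>h x\<bar>"] by auto
    obtain e where e: "e > 0" "ball x e \<subseteq> S"
      using S x(2) openE by blast
    define r where "r = min d (e / real DIM('a)) / 2"
    have r: "0 < r" "r < d" "r * real DIM('a) < e"
      using d e by (auto simp: r_def min_def field_simps)
    have "cbox x (x + r *\<^sub>R One) \<subseteq> ball x e"
    proof
      fix y assume y: "y \<in> cbox x (x + r *\<^sub>R One)"
      have "norm (y - x) \<le> (\<Sum>b\<in>Basis. \<bar>(y - x) \<bullet> b\<bar>)" by (rule norm_le_l1)
      also have "\<dots> \<le> (\<Sum>b\<in>(Basis::'a set). r)"
        using y by (intro sum_mono) (auto simp: mem_box inner_diff_left inner_add_left algebra_simps)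
      also have "\<dots> < e" using r by (simp add: mult.commute)
      finally show "y \<in> ball x e" by (simp add: dist_norm norm_minus_commute)
    qed
    then have "integral (cbox x (x + r *\<^sub>R One)) h = 0"
      using e by (intro zero) auto
    with close[of r] r show False by simp
  qed
  then have "AE x in lebesgue. x \<in> S \<longrightarrow> h x = 0"
    using N by (intro AE_I'[of N]) (auto simp: negligible_iff_null_sets)
  then show ?thesis by (simp add: AE_completion_iff)
qed

lemma mult_powr_tendsto_0:
  fixes s :: "nat \<Rightarrow> real"
  assumes "s \<longlonglongrightarrow> 0" "\<And>n. 0 < s n" "0 < \<alpha>"
  shows "(\<lambda>n. K * s n powr \<alpha>) \<longlonglongrightarrow> 0"
proof (rule tendsto_mult_right_zero, rule tendsto_zero_powrI[OF assms(1) tendsto_const _ assms(3)])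
  show "\<forall>\<^sub>F n in sequentially. 0 \<le> s n"
    by (intro always_eventually allI less_imp_le assms(2))
qed

text \<open>Uniform convergence of the averages gives convergence of their integrals over a box. By Fubini's
  theorem these are integrals of \<open>f\<close> against the mass that the kernels with vertex in the box put
  on a point, and that mass tends to the indicator of the box. So \<open>f\<close> and \<open>H\<close> have the same
  integral over each box inside the ball.\<close>

lemma cone_average_limit_AE:
  fixes c :: "real^'n::finite" and f H :: "real^'n \<Rightarrow> real"
  assumes f: "integrable lborel f" and R: "0 < R"
    and H: "continuous_on (ball c (2 * R)) H" "\<And>z. z \<in> ball c (2 * R) \<Longrightarrow> \<bar>H z\<bar> \<le> L"
    and \<alpha>: "0 < \<alpha>"
    and lim: "\<And>\<sigma> z. \<lbrakk>0 < \<sigma>; \<sigma> \<le> 1; z \<in> ball c (2 * R)\<rbrakk> \<Longrightarrow>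
      \<bar>cone_average c R f z \<sigma> - H z\<bar> \<le> K * \<sigma> powr \<alpha>"
  shows "AE x in lborel. x \<in> ball c (2 * R) \<longrightarrow> f x = H x"
proof -
  let ?B = "ball c (2 * R)"
  have [measurable]: "f \<in> borel_measurable borel" using f by auto
  have Hm [measurable]: "(\<lambda>x. indicator ?B x * H x) \<in> borel_measurable borel"
    using borel_measurable_continuous_on_indicator[OF _ H(1)] by simp
  have intH: "integrable lborel (\<lambda>x. indicator ?B x * H x)"
  proof (rule Bochner_Integration.integrable_bound)
    show "integrable lborel (\<lambda>x. indicator ?B x * L)"
      using integrable_real_indicator[of ?B lborel] emeasure_lborel_ball_finite[of c "2 * R"] by simp
    show "AE x in lborel. norm (indicator ?B x * H x) \<le> norm (indicator ?B x * L)"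
      using H(2) by (intro AE_I2) (force simp: indicator_def)
    show "(\<lambda>x. indicator ?B x * H x) \<in> borel_measurable lborel"
      by measurable
  qed
  have "AE x in lborel. x \<in> ?B \<longrightarrow> f x - indicator ?B x * H x = 0"
  proof (rule eq_0_AE_if_box_integrals_0[OF _ open_ball])
    show "integrable lborel (\<lambda>x. f x - indicator ?B x * H x)"
      using f intH by simp
    fix a b assume E: "cbox a b \<subseteq> ?B"
    let ?E = "cbox a b"
    define \<sigma> where "\<sigma> i = inverse (real (Suc (Suc i)))" for i
    have \<sigma>: "0 < \<sigma> i" "\<sigma> i < 1" "\<sigma> i \<le> 1 / 2" for i
      by (auto simp: \<sigma>_def field_simps)
    have \<sigma>0: "\<sigma> \<longlonglongrightarrow> 0"
      unfolding \<sigma>_def by (rule LIMSEQ_Suc[OF LIMSEQ_inverse_real_of_nat])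
    have [measurable]: "(\<lambda>z. cone_average c R f z (\<sigma> i)) \<in> borel_measurable borel" for i
      by (rule borel_measurable_continuous_onI[OF continuous_on_cone_average[OF f \<sigma>(1) R]])
    have lim1: "(\<lambda>i. LINT z|lborel. indicator ?E z * cone_average c R f z (\<sigma> i))
        \<longlonglongrightarrow> (LINT z|lborel. indicator ?E z * (indicator ?B z * H z))"
    proof (rule integral_dominated_convergence)
      show "integrable lborel (\<lambda>z. indicator ?E z * (L + \<bar>K\<bar>))"
        using integrable_real_indicator[of ?E lborel] emeasure_lborel_cbox_finite[of a b] by simp
      show "AE z in lborel. (\<lambda>i. indicator ?E z * cone_average c R f z (\<sigma> i))
          \<longlonglongrightarrow> indicator ?E z * (indicator ?B z * H z)"
      proof (rule AE_I2)
        fix z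
        show "(\<lambda>i. indicator ?E z * cone_average c R f z (\<sigma> i)) \<longlonglongrightarrow> indicator ?E z * (indicator ?B z * H z)"
        proof (cases "z \<in> ?E")
          case True
          then have z: "z \<in> ?B" using E by blast
          have "norm (cone_average c R f z (\<sigma> i) - H z) \<le> K * \<sigma> i powr \<alpha>" for i
            using lim[OF \<sigma>(1) less_imp_le[OF \<sigma>(2)] z] by simp
          then have "(\<lambda>i. cone_average c R f z (\<sigma> i) - H z) \<longlonglongrightarrow> 0"
            by (intro Lim_null_comparison[OF always_eventually mult_powr_tendsto_0[OF \<sigma>0 \<sigma>(1) \<alpha>]]) blast
          then show ?thesis
            using True z by (simp add: LIM_zero_iff)
        qed simp
      qed
      show "AE z in lborel. norm (indicator ?E z * cone_average c R f z (\<sigma> i)) \<le> indicator ?E z * (L + \<bar>K\<bar>)" for i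
      proof (rule AE_I2)
        fix z
        show "norm (indicator ?E z * cone_average c R f z (\<sigma> i)) \<le> indicator ?E z * (L + \<bar>K\<bar>)"
        proof (cases "z \<in> ?E")
          case True
          then have z: "z \<in> ?B" using E by blast
          have "K * \<sigma> i powr \<alpha> \<le> \<bar>K\<bar> * 1"
            using \<alpha> \<sigma>[of i] by (intro mult_mono powr_le1) auto
          then have "\<bar>cone_average c R f z (\<sigma> i)\<bar> \<le> L + \<bar>K\<bar>"
            using lim[of "\<sigma> i" z] H(2)[OF z] z \<sigma>[of i] by linarith
          then show ?thesis using True by simp
        qed simp
      qed
      show "(\<lambda>z. indicator ?E z * (indicator ?B z * H z)) \<in> borel_measurable lborel"
        by measurable
      show "(\<lambda>z. indicator ?E z * cone_average c R f z (\<sigma> i)) \<in> borel_measurable lborel" for i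
        by measurable
    qed
    have lim2: "(\<lambda>i. LINT x|lborel. (LINT z|lborel. indicator ?E z * cone_kernel c R z (\<sigma> i) x) * f x)
        \<longlonglongrightarrow> (LINT x|lborel. indicator ?E x * f x)"
    proof (rule integral_dominated_convergence)
      show "integrable lborel (\<lambda>x. 2 ^ CARD('n) * \<bar>f x\<bar>)" using f by simp
      have [measurable]: "(mollifier :: real^'n \<Rightarrow> real) \<in> borel_measurable borel"
        by (rule borel_measurable_continuous_onI[OF continuous_on_mollifier])
      show "(\<lambda>x. (LINT z|lborel. indicator ?E z * cone_kernel c R z (\<sigma> i) x) * f x) \<in> borel_measurable lborel" for i
        unfolding cone_kernel_def cone_arg_def by measurable
      have "AE x in lebesgue. x \<notin> frontier ?E"
        using negligible_convex_frontier[OF convex_box(1)]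
        by (intro AE_not_in) (simp add: negligible_iff_null_sets)
      then have "AE x in lborel. x \<notin> frontier ?E" by (simp add: AE_completion_iff)
      then show "AE x in lborel. (\<lambda>i. (LINT z|lborel. indicator ?E z * cone_kernel c R z (\<sigma> i) x) * f x)
          \<longlonglongrightarrow> indicator ?E x * f x"
        by eventually_elim (intro tendsto_mult tendsto_const cone_kernel_vertex_tendsto \<sigma> \<sigma>0 R, auto)
      show "AE x in lborel. norm ((LINT z|lborel. indicator ?E z * cone_kernel c R z (\<sigma> i) x) * f x)
          \<le> 2 ^ CARD('n) * \<bar>f x\<bar>" for i
        unfolding real_norm_def abs_mult
        by (intro AE_I2 mult_right_mono cone_kernel_vertex_mass \<sigma> R) auto
      show "(\<lambda>x. indicator ?E x * f x) \<in> borel_measurable lborel"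
        by measurable
    qed
    have "(LINT x|lborel. indicator ?E x * f x) = (LINT z|lborel. indicator ?E z * (indicator ?B z * H z))"
      using LIMSEQ_unique[OF lim2] lim1 by (simp add: integral_cone_average_box[OF f \<sigma>(1) R])
    moreover have "integrable lborel (\<lambda>x. indicator ?E x *\<^sub>R f x)"
      "integrable lborel (\<lambda>x. indicator ?E x *\<^sub>R (indicator ?B x * H x))"
      using f intH by (intro integrable_mult_indicator; simp)+
    ultimately show "(LINT x|lborel. indicator ?E x * (f x - indicator ?B x * H x)) = 0"
      by (simp add: right_diff_distrib)
  qed
  then show ?thesis by (rule eventually_mono) (simp add: indicator_def split: if_splits)
qed

section \<open>Morrey's inequality\<close>

text \<open>The averages are uniformly Cauchy as \<open>\<tau>\<close> tends to \<open>0\<close>. Their limit \<open>H\<close> is continuous, agrees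
  with \<open>f\<close> almost everywhere and differs from the common value \<open>m\<close> at \<open>\<tau> = 1\<close> by at most the
  bound of \<open>cone_average_diff_le\<close>. Vertices anywhere in the ball are allowed, and only the
  gradient inside the ball enters; both matter when balls are later chosen to touch a level set.\<close>

theorem Morrey_ball:
  fixes c :: "real^'n::finite"
  assumes w: "weak_gradient_ball c (2 * R) f g"
    and gt: "integrable lborel (\<lambda>x. norm (g x) powr t)" "(LINT x|lborel. norm (g x) powr t) \<le> \<Gamma> powr t"
    and t: "real CARD('n) < t" and \<Gamma>: "0 < \<Gamma>" and R: "0 < R"
  defines "\<alpha> \<equiv> 1 - real CARD('n) / t"
  obtains H m where "continuous_on (ball c (2 * R)) H" "AE x in lborel. x \<in> ball c (2 * R) \<longrightarrow> f x = H x"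
    "\<And>z. z \<in> ball c (2 * R) \<Longrightarrow> \<bar>H z - m\<bar> \<le> morrey_const TYPE('n) t * R powr \<alpha> * \<Gamma>"
proof -
  let ?B = "ball c (2 * R)" and ?F = "cone_average c R f"
  define Q where "Q = morrey_const TYPE('n) t * R powr \<alpha> * \<Gamma>"
  have t0: "0 < t" using t by (meson of_nat_0_le_iff order_le_less_trans)
  have \<alpha>: "0 < \<alpha>" using t t0 by (simp add: \<alpha>_def)
  have Q: "0 < Q"
    using mollifier_max_pos[where 'n='n] \<alpha> R \<Gamma>
    by (simp add: Q_def morrey_const_def \<alpha>_def)
  have f: "integrable lborel f" using w by (simp add: weak_gradient_ball_def)
  have diff: "\<bar>?F z \<tau> - ?F z \<sigma>\<bar> \<le> Q * (\<tau> powr \<alpha> - \<sigma> powr \<alpha>)"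
    if "z \<in> ?B" "0 < \<sigma>" "\<sigma> \<le> \<tau>" "\<tau> \<le> 1" for z \<sigma> \<tau>
    unfolding Q_def \<alpha>_def by (rule cone_average_diff_le[OF w gt t \<Gamma> R that])
  have diff': "\<bar>?F z \<tau> - ?F z \<sigma>\<bar> \<le> Q * \<tau> powr \<alpha>"
    if "z \<in> ?B" "0 < \<sigma>" "\<sigma> \<le> \<tau>" "\<tau> \<le> 1" for z \<sigma> \<tau>
  proof -
    have "Q * (\<tau> powr \<alpha> - \<sigma> powr \<alpha>) \<le> Q * \<tau> powr \<alpha>"
      using Q by (intro mult_left_mono) auto
    then show ?thesis using diff[OF that] by linarith
  qed
  define s where "s n = inverse (real (Suc n))" for n
  have s: "0 < s n" "s n \<le> 1" for n by (auto simp: s_def field_simps)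
  have s_mono: "s n \<le> s m" if "m \<le> n" for m n using that by (simp add: s_def)
  have s0: "s \<longlonglongrightarrow> 0" unfolding s_def by (rule LIMSEQ_inverse_real_of_nat)
  have "uniformly_Cauchy_on ?B (\<lambda>n z. ?F z (s n))"
  proof (rule uniformly_Cauchy_onI')
    fix e :: real assume e: "0 < e"
    have "\<forall>\<^sub>F n in sequentially. Q * s n powr \<alpha> < e"
      by (rule order_tendstoD(2)[OF mult_powr_tendsto_0[OF s0 s(1) \<alpha>] e])
    then obtain M where M: "\<And>n. n \<ge> M \<Longrightarrow> Q * s n powr \<alpha> < e"
      by (auto simp: eventually_sequentially)
    have "dist (?F z (s m)) (?F z (s n)) < e" if "z \<in> ?B" "m \<ge> M" "n > m" for z m n
      using diff'[OF that(1) s(1) s_mono s(2), of m n] M[of m] that by (simp add: dist_real_def)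
    then show "\<exists>M. \<forall>z\<in>?B. \<forall>m\<ge>M. \<forall>n>m. dist (?F z (s m)) (?F z (s n)) < e"
      by blast
  qed
  then obtain H where H: "uniform_limit ?B (\<lambda>n z. ?F z (s n)) H sequentially"
    using uniformly_convergent_eq_Cauchy uniformly_convergent_on_def by blast
  have contH: "continuous_on ?B H"
    by (rule uniform_limit_theorem[OF always_eventually H])
       (auto intro: continuous_on_cone_average[OF f s(1) R])
  have limH: "\<bar>?F z \<sigma> - H z\<bar> \<le> Q * \<sigma> powr \<alpha>" if "0 < \<sigma>" "\<sigma> \<le> 1" "z \<in> ?B" for \<sigma> z
  proof (rule tendsto_upperbound[of "\<lambda>n. \<bar>?F z \<sigma> - ?F z (s n)\<bar>"])
    show "(\<lambda>n. \<bar>?F z \<sigma> - ?F z (s n)\<bar>) \<longlonglongrightarrow> \<bar>?F z \<sigma> - H z\<bar>"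
      by (intro tendsto_intros tendsto_uniform_limitI[OF H] that)
    have "\<forall>\<^sub>F n in sequentially. s n < \<sigma>"
      using order_tendstoD(2)[OF s0] that by blast
    then show "\<forall>\<^sub>F n in sequentially. \<bar>?F z \<sigma> - ?F z (s n)\<bar> \<le> Q * \<sigma> powr \<alpha>"
      by eventually_elim (use diff' s that in auto)
  qed simp
  define m where "m = ?F c 1"
  have osc: "\<bar>H z - m\<bar> \<le> Q" if "z \<in> ?B" for z
    using limH[of 1 z] that cone_average_1[of c R f z c] by (simp add: m_def abs_minus_commute)
  have "AE x in lborel. x \<in> ?B \<longrightarrow> f x = H x"
  proof (rule cone_average_limit_AE[OF f R contH _ \<alpha> limH])
    show "\<bar>H z\<bar> \<le> \<bar>m\<bar> + Q" if "z \<in> ?B" for z using osc[OF that] by linarith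
  qed
  then show ?thesis using that[OF contH _ osc[unfolded Q_def]] by blast
qed

lemma test_function_eq_0:
  assumes "test_function S \<phi>" "x \<notin> S"
  shows "\<phi> x = 0"
proof (rule ccontr)
  assume "\<phi> x \<noteq> 0"
  then have "x \<in> closure {x. \<phi> x \<noteq> 0}"
    using closure_subset[of "{x. \<phi> x \<noteq> 0}"] by auto
  then show False using assms by (auto simp: test_function_def)
qed

text \<open>The complement of the support is open, and the function vanishes on it.\<close>

lemma test_function_grad_eq_0:
  assumes \<phi>: "test_function S \<phi>" and D: "GDERIV \<phi> x :> D" and x: "x \<notin> S"
  shows "D = 0"
proof -
  let ?U = "- closure {x. \<phi> x \<noteq> 0}"
  have xU: "x \<in> ?U" using \<phi> x by (auto simp: test_function_def)
  have "((\<lambda>x. 0) has_derivative (\<lambda>h. h \<bullet> D)) (at x)"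
  proof (rule has_derivative_transform_within_open[of \<phi> _ _ _ ?U])
    show "(\<phi> has_derivative (\<lambda>h. h \<bullet> D)) (at x)" using D by (simp add: gderiv_def)
    show "\<phi> y = 0" if "y \<in> ?U" for y
      using that closure_subset[of "{x. \<phi> x \<noteq> 0}"] by auto
  qed (use xU in auto)
  then have "(\<lambda>h. h \<bullet> D) = (\<lambda>h. 0)"
    by (rule has_derivative_unique) (rule has_derivative_const)
  then have "D \<bullet> D = 0" by meson
  then show ?thesis by simp
qed

lemma test_function_mono: "test_function S \<phi> \<Longrightarrow> S \<subseteq> T \<Longrightarrow> test_function T \<phi>"
  unfolding test_function_def by blast

lemma weak_gradient_ball_subset:
  assumes w: "weak_gradient_ball c \<rho> f g" and sub: "ball c' \<rho>' \<subseteq> ball c \<rho>"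
  shows "weak_gradient_ball c' \<rho>' (\<lambda>x. indicator (ball c' \<rho>') x * f x)
    (\<lambda>x. indicator (ball c' \<rho>') x *\<^sub>R g x)"
  unfolding weak_gradient_ball_def
proof (intro conjI allI impI)
  let ?B = "ball c' \<rho>'"
  show "integrable lborel (\<lambda>x. indicator ?B x * f x)"
    using w integrable_mult_indicator[of ?B lborel f] by (simp add: weak_gradient_ball_def)
  show "integrable lborel (\<lambda>x. indicator ?B x *\<^sub>R g x)"
    using w integrable_mult_indicator[of ?B lborel g] by (simp add: weak_gradient_ball_def)
  fix \<phi> \<phi>' i
  assume A: "test_function ?B \<phi> \<and> (\<forall>x. GDERIV \<phi> x :> \<phi>' x)"
  have "\<phi>' x $ i * (indicator ?B x * f x) = \<phi>' x $ i * f x" for x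
    using test_function_grad_eq_0[of ?B \<phi> x "\<phi>' x"] A by (cases "x \<in> ?B") auto
  moreover have "\<phi> x * (indicator ?B x *\<^sub>R g x) $ i = \<phi> x * g x $ i" for x
    using test_function_eq_0[of ?B \<phi> x] A by (cases "x \<in> ?B") auto
  moreover have "(LINT x|lborel. \<phi>' x $ i * f x) = - (LINT x|lborel. \<phi> x * g x $ i)"
    using w A test_function_mono[OF _ sub] unfolding weak_gradient_ball_def by blast
  ultimately show "(LINT x|lborel. \<phi>' x $ i * (indicator ?B x * f x))
      = - (LINT x|lborel. \<phi> x * (indicator ?B x *\<^sub>R g x) $ i)"
    by presburger
qed auto

lemma continuous_AE_eq_imp_eq:
  fixes f h :: "'a::euclidean_space \<Rightarrow> real"
  assumes S: "open S" and f: "continuous_on S f" and h: "continuous_on S h"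
    and ae: "AE x in lborel. x \<in> S \<longrightarrow> f x = h x" and x: "x \<in> S"
  shows "f x = h x"
proof (rule ccontr)
  assume neq: "f x \<noteq> h x"
  let ?U = "S \<inter> (\<lambda>x. f x - h x) -` (- {0})"
  have U: "open ?U"
    by (rule continuous_open_preimage[OF continuous_on_diff[OF f h] S]) auto
  have "AE x in lborel. x \<notin> ?U"
    using ae by eventually_elim auto
  then have "?U \<in> null_sets lborel"
    using U by (subst AE_iff_null_sets) auto
  then have "negligible ?U"
    by (simp add: negligible_iff_null_sets null_sets_completionI)
  moreover have "x \<in> ?U" using x neq by simp
  ultimately show False
    using open_not_negligible[OF U] by blast
qed

text \<open>On the smaller ball \<open>Morrey_ball\<close> yields a continuous representative of its own, which must
  coincide with \<open>H\<close> because continuous functions that agree almost everywhere on an open set agree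
  on it.\<close>

lemma Morrey_subball:
  fixes c :: "real^'n::finite"
  assumes w: "weak_gradient_ball c \<rho> f g" and gt: "integrable lborel (\<lambda>x. norm (g x) powr t)"
    and t: "real CARD('n) < t" and \<Gamma>: "0 < \<Gamma>" and s: "0 < s" and sub: "ball z s \<subseteq> ball c \<rho>"
    and H: "continuous_on (ball c \<rho>) H" "AE x in lborel. x \<in> ball c \<rho> \<longrightarrow> f x = H x"
    and le: "(LINT x|lborel. indicator (ball z s) x * norm (g x) powr t) \<le> \<Gamma> powr t"
    and x: "x \<in> ball z s"
  shows "\<bar>H x - H z\<bar> \<le> 2 * morrey_const TYPE('n) t * s powr (1 - real CARD('n) / t) * \<Gamma>"
proof -
  let ?S = "ball z s" and ?\<alpha> = "1 - real CARD('n) / t"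
  have t0: "0 < t" using t by (meson of_nat_0_le_iff order_le_less_trans)
  have w': "weak_gradient_ball z (2 * (s / 2)) (\<lambda>x. indicator ?S x * f x) (\<lambda>x. indicator ?S x *\<^sub>R g x)"
    using weak_gradient_ball_subset[OF w sub] by simp
  have eq: "norm (indicator ?S x *\<^sub>R g x) powr t = indicator ?S x * norm (g x) powr t" for x
    by (simp add: indicator_def)
  have int: "integrable lborel (\<lambda>x. norm (indicator ?S x *\<^sub>R g x) powr t)"
    unfolding eq using integrable_mult_indicator[OF _ gt, of ?S] by simp
  have le': "(LINT x|lborel. norm (indicator ?S x *\<^sub>R g x) powr t) \<le> \<Gamma> powr t"
    unfolding eq by (rule le)
  obtain H' m where H': "continuous_on ?S H'" "AE x in lborel. x \<in> ?S \<longrightarrow> indicator ?S x * f x = H' x"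
    and osc: "\<And>x. x \<in> ?S \<Longrightarrow> \<bar>H' x - m\<bar> \<le> morrey_const TYPE('n) t * (s / 2) powr ?\<alpha> * \<Gamma>"
    using Morrey_ball[OF w' int le' t \<Gamma>] s by auto
  have "AE x in lborel. x \<in> ?S \<longrightarrow> H x = H' x"
    using H(2) H'(2) by eventually_elim (use sub in auto)
  then have same: "H x = H' x" if "x \<in> ?S" for x
    using continuous_AE_eq_imp_eq[OF open_ball continuous_on_subset[OF H(1) sub] H'(1)] that by blast
  have "\<bar>H x - m\<bar> \<le> morrey_const TYPE('n) t * (s / 2) powr ?\<alpha> * \<Gamma>"
    "\<bar>H z - m\<bar> \<le> morrey_const TYPE('n) t * (s / 2) powr ?\<alpha> * \<Gamma>"
    using osc x s same by auto
  moreover have "morrey_const TYPE('n) t * (s / 2) powr ?\<alpha> * \<Gamma> \<le> morrey_const TYPE('n) t * s powr ?\<alpha> * \<Gamma>"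
    using t t0 s \<Gamma> mollifier_max_pos[where 'n='n]
    by (intro mult_right_mono mult_left_mono powr_mono2) (auto simp: morrey_const_def)
  ultimately show ?thesis by linarith
qed

section \<open>The supremum bound for continuous functions\<close>

lemma integral_indicator_ge:
  fixes \<psi> :: "real^'n::finite \<Rightarrow> real"
  assumes A: "open A" "A \<subseteq> ball c \<rho>" and \<psi>: "continuous_on A \<psi>" "\<And>x. x \<in> A \<Longrightarrow> 0 \<le> \<psi> x \<and> \<psi> x \<le> L"
    and S: "ball z s \<subseteq> A" "0 < s" and v: "\<And>x. x \<in> ball z s \<Longrightarrow> v \<le> \<psi> x"
  shows "v * (measure lborel (ball (0::real^'n) 1) * s ^ CARD('n)) \<le> (LINT x|lborel. indicator A x * \<psi> x)"
proof -
  have [measurable]: "A \<in> sets borel" using A by auto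
  have m [measurable]: "(\<lambda>x. indicator A x * \<psi> x) \<in> borel_measurable borel"
    using borel_measurable_continuous_on_indicator[OF _ \<psi>(1)] by simp
  have "emeasure lborel A \<le> emeasure lborel (ball c \<rho>)"
    using A by (intro emeasure_mono) auto
  then have fin: "emeasure lborel A < \<infinity>"
    using emeasure_lborel_ball_finite[of c \<rho>] by (simp add: order_le_less_trans)
  have int: "integrable lborel (\<lambda>x. indicator A x * \<psi> x)"
  proof (rule Bochner_Integration.integrable_bound)
    show "integrable lborel (\<lambda>x. indicator A x * L)"
      using integrable_real_indicator[of A lborel] fin by simp
    show "AE x in lborel. norm (indicator A x * \<psi> x) \<le> norm (indicator A x * L)"
      using \<psi>(2) by (intro AE_I2) (force simp: indicator_def)
  qed (use m in simp)
  have "v * measure lborel (ball z s) = (LINT x|lborel. indicator (ball z s) x * v)"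
    using emeasure_lborel_ball_finite[of z s] by simp
  also have "\<dots> \<le> (LINT x|lborel. indicator A x * \<psi> x)"
  proof (rule integral_mono[OF _ int])
    show "integrable lborel (\<lambda>x. indicator (ball z s) x * v)"
      using integrable_real_indicator[of "ball z s" lborel] emeasure_lborel_ball_finite[of z s] by simp
    show "indicator (ball z s) x * v \<le> indicator A x * \<psi> x" for x
      using v[of x] \<psi>(2)[of x] S by (auto simp: indicator_def)
  qed
  finally show ?thesis
    using S(2) content_ball_conv_unit_ball[of s z] by (simp add: mult.commute)
qed

text \<open>In the lower bounds for \<open>X\<close> and \<open>V\<close> the powers of \<open>\<rho>\<close> combine to \<open>\<rho> powr (a * \<alpha>)\<close>, and
  together with \<open>\<Gamma> powr a\<close> they form the \<open>a\<close>-th power of \<open>\<rho> powr \<alpha> * \<Gamma>\<close>, which is at least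
  \<open>(\<kappa> * M) powr a\<close>. The remaining factor \<open>M powr b\<close> comes from \<open>X\<close>, and \<open>a + b = 1\<close>.\<close>

lemma interpolation_lower_bound:
  fixes M :: real
  assumes pos: "0 < M" "0 < \<rho>" "0 < \<Gamma>" "0 < \<omega>" "0 < \<kappa>" and \<kappa>: "\<kappa> * M \<le> \<rho> powr \<alpha> * \<Gamma>"
    and abe: "0 \<le> a" "0 \<le> b" "0 \<le> e" "a + b = 1" "n * (b / 2 + e) = a * \<alpha>"
    and X: "(M / 2)\<^sup>2 * (\<omega> * \<rho> powr n) \<le> X" and V: "\<omega> * \<rho> powr n \<le> V"
  shows "\<kappa> powr a * (1 / 2) powr b * \<omega> powr (b / 2 + e) * M \<le> \<Gamma> powr a * X powr (b / 2) * V powr e"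
proof -
  have "\<kappa> powr a * (1 / 2) powr b * \<omega> powr (b / 2 + e) * M
      = (\<kappa> * M) powr a * ((M / 2) powr b * \<omega> powr (b / 2 + e))"
  proof -
    have M: "M powr a * M powr b = M"
      using pos abe by (simp flip: powr_add)
    have half: "(M / 2) powr b = M powr b * (1 / 2) powr b"
      using pos powr_mult[of M "1 / 2" b] by simp
    have kappa: "(\<kappa> * M) powr a = \<kappa> powr a * M powr a"
      using pos by (simp add: powr_mult)
    have "(\<kappa> * M) powr a * ((M / 2) powr b * \<omega> powr (b / 2 + e))
        = \<kappa> powr a * (1 / 2) powr b * \<omega> powr (b / 2 + e) * (M powr a * M powr b)"
      unfolding half kappa by (simp only: mult_ac)
    then show ?thesis unfolding M by (rule sym)
  qed
  also have "\<dots> \<le> (\<rho> powr \<alpha> * \<Gamma>) powr a * ((M / 2) powr b * \<omega> powr (b / 2 + e))"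
    using pos abe \<kappa> by (intro mult_right_mono powr_mono2) auto
  also have "\<dots> = \<Gamma> powr a * ((M / 2)\<^sup>2 * (\<omega> * \<rho> powr n)) powr (b / 2) * (\<omega> * \<rho> powr n) powr e"
  proof -
    have 1: "(\<rho> powr \<alpha> * \<Gamma>) powr a = \<Gamma> powr a * \<rho> powr (n * (b / 2 + e))"
      using pos abe(5) by (simp add: powr_mult powr_powr mult_ac)
    have 2: "((M / 2)\<^sup>2 * (\<omega> * \<rho> powr n)) powr (b / 2)
        = (M / 2) powr b * (\<omega> powr (b / 2) * \<rho> powr (n * (b / 2)))"
    proof -
      have "((M / 2)\<^sup>2) powr (b / 2) = (M / 2) powr b"
        using pos powr_powr[of "M / 2" 2 "b / 2"] by (simp del: power_divide)
      then show ?thesis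
        using pos by (simp add: powr_mult powr_powr del: power_divide)
    qed
    have 3: "(\<omega> * \<rho> powr n) powr e = \<omega> powr e * \<rho> powr (n * e)"
      using pos by (simp add: powr_mult powr_powr)
    show ?thesis
      unfolding 1 2 3 distrib_left powr_add by (simp only: mult_ac)
  qed
  also have "\<dots> \<le> \<Gamma> powr a * X powr (b / 2) * V powr e"
    using pos abe X V by (intro mult_mono powr_mono2) auto
  finally show ?thesis .
qed

lemma morrey_const_pos: "real CARD('n::finite) < t \<Longrightarrow> 0 < morrey_const TYPE('n) t"
  using mollifier_max_pos[where 'n='n] order_le_less_trans[of 0 "real CARD('n)" t]
  by (simp add: morrey_const_def)

text \<open>The two entries of the minimum belong to the two choices of the radius \<open>\<rho>\<close> in
  \<open>sup_bound_continuous\<close>.\<close>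

definition growth_const :: "'n::finite itself \<Rightarrow> real \<Rightarrow> real" where
  "growth_const _ t = min (1 / (4 * morrey_const TYPE('n) t))
     (measure lborel (ball (0::real^'n) 1) powr (1 / t) / 4)"

lemma growth_const_pos:
  assumes "real CARD('n::finite) < t"
  shows "0 < growth_const TYPE('n) t"
  using morrey_const_pos[OF assms] content_ball_pos[of 1 "0::real^'n"] by (simp add: growth_const_def)

text \<open>The reciprocal of the constant in the supremum bound.\<close>

definition sup_const :: "'n::finite itself \<Rightarrow> real \<Rightarrow> real \<Rightarrow> real \<Rightarrow> real \<Rightarrow> real" where
  "sup_const _ t a b e = growth_const TYPE('n) t powr a * (1 / 2) powr b
     * measure lborel (ball (0::real^'n) 1) powr (b / 2 + e)"

lemma sup_const_pos:
  assumes "real CARD('n::finite) < t"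
  shows "0 < sup_const TYPE('n) t a b e"
proof -
  have "0 < measure lborel (ball (0::real^'n) 1)" by (rule content_ball_pos) simp
  then show ?thesis
    using growth_const_pos[OF assms] unfolding sup_const_def by (intro mult_pos_pos) simp_all
qed

text \<open>Suppose that \<open>H\<close> drops to the level \<open>k\<close> inside the ball, and let \<open>z0\<close> be a nearest point to \<open>x0\<close>
  where it does. On the ball about \<open>x0\<close> that has \<open>z0\<close> on its boundary \<open>H\<close> is above \<open>k\<close>, so the
  oscillation bound holds there. By continuity it holds at \<open>z0\<close> as well, but then \<open>H\<close> has lost at
  most half of \<open>H x0 - k\<close>.\<close>

lemma ball_above_level:
  fixes H :: "real^'n::finite \<Rightarrow> real"
  assumes H: "continuous_on (ball y r) H" and sub: "ball x0 \<rho> \<subseteq> ball y r" and \<alpha>: "0 < \<alpha>"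
    and osc: "\<And>s x. \<lbrakk>0 < s; ball x0 s \<subseteq> {x \<in> ball y r. k < H x}; x \<in> ball x0 s\<rbrakk>
      \<Longrightarrow> \<bar>H x - H x0\<bar> \<le> Q * s powr \<alpha>"
    and Q: "0 < Q" "2 * (Q * \<rho> powr \<alpha>) \<le> H x0 - k" and above: "k < H x0"
  shows "ball x0 \<rho> \<subseteq> {x \<in> ball y r. k < H x}"
proof (rule ccontr)
  assume "\<not> ?thesis"
  then obtain z where z: "z \<in> ball x0 \<rho>" "H z \<le> k" using sub by (auto simp: not_less subset_iff)
  define S where "S = cball x0 (dist x0 z) \<inter> H -` {..k}"
  have cb: "cball x0 (dist x0 z) \<subseteq> ball x0 \<rho>" using z(1) by auto
  have "closed S"
    unfolding S_def
    by (rule continuous_closed_preimage[OF continuous_on_subset[OF H]]) (use cb sub in auto)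
  moreover have "S \<noteq> {}" using z by (auto simp: S_def)
  ultimately obtain z0 where z0: "z0 \<in> S" and near: "\<And>w. w \<in> S \<Longrightarrow> dist x0 z0 \<le> dist x0 w"
    using distance_attains_inf[of S x0] by blast
  define s where "s = dist x0 z0"
  have s: "0 < s" using z0 above by (auto simp: s_def S_def)
  have s\<rho>: "s < \<rho>" using z0 z(1) by (auto simp: s_def S_def)
  have inside: "ball x0 s \<subseteq> {x \<in> ball y r. k < H x}"
  proof
    fix w assume w: "w \<in> ball x0 s"
    then have wr: "w \<in> ball y r" using subset_ball[of s \<rho> x0] s\<rho> sub by (meson less_imp_le subsetD)
    have "\<not> H w \<le> k"
    proof
      assume "H w \<le> k"
      then have "w \<in> S" using w z0 by (auto simp: S_def s_def)
      from near[OF this] w show False by (simp add: s_def)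
    qed
    with wr show "w \<in> {x \<in> ball y r. k < H x}" by simp
  qed
  have "\<bar>H z0 - H x0\<bar> \<le> Q * s powr \<alpha>"
  proof (rule continuous_le_on_closure[where S = "ball x0 s" and f = "\<lambda>x. \<bar>H x - H x0\<bar>"])
    have "closure (ball x0 s) \<subseteq> ball y r"
      using cball_subset_ball_iff[of x0 s x0 \<rho>] s s\<rho> sub by auto
    then show "continuous_on (closure (ball x0 s)) (\<lambda>x. \<bar>H x - H x0\<bar>)"
      by (intro continuous_intros continuous_on_subset[OF H])
    show "z0 \<in> closure (ball x0 s)" using s by (simp add: s_def)
  qed (rule osc[OF s inside])
  moreover have "H z0 \<le> k" using z0 by (simp add: S_def)
  moreover have "Q * s powr \<alpha> < Q * \<rho> powr \<alpha>"
    using Q(1) s s\<rho> \<alpha> by (intro mult_strict_left_mono powr_less_mono2) auto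
  ultimately show False using Q above by linarith
qed

text \<open>Let \<open>M = H x0 - k\<close>. On a ball about \<open>x0\<close> whose radius \<open>\<rho>\<close> is such that the Morrey bound is at
  most \<open>M / 2\<close>, the values of \<open>H\<close> stay above \<open>k + M / 2\<close>. Hence \<open>X\<close> and the measure of \<open>A\<close>
  are bounded below in terms of \<open>M\<close> and \<open>\<rho>\<close>. Either \<open>\<rho>\<close> is determined by the Morrey bound, which
  makes \<open>\<rho> powr \<alpha> * \<Gamma>\<close> proportional to \<open>M\<close>, or \<open>\<rho> = r / 2\<close>, and then the integral \<open>U\<close>
  already gives such a lower bound.\<close>

lemma sup_bound_continuous:
  fixes y :: "real^'n::finite" and f H :: "real^'n \<Rightarrow> real" and k :: real
  assumes w: "weak_gradient_ball y r f g" and gt: "integrable lborel (\<lambda>x. norm (g x) powr t)"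
    and t: "real CARD('n) < t" and r: "0 < r"
    and H: "continuous_on (ball y r) H" "AE x in lborel. x \<in> ball y r \<longrightarrow> f x = H x"
    and abe: "0 \<le> a" "0 \<le> b" "0 \<le> e" "a + b = 1"
      "real CARD('n) * (b / 2 + e) = a * (1 - real CARD('n) / t)"
    and x0: "x0 \<in> ball y (r / 2)"
  defines "A \<equiv> {x \<in> ball y r. k < H x}"
  defines "U \<equiv> LINT x|lborel. indicator A x * \<bar>H x - k\<bar> powr t"
  defines "V \<equiv> LINT x|lborel. indicator A x * norm (g x) powr t"
  defines "X \<equiv> LINT x|lborel. indicator A x * (H x - k)\<^sup>2"
  shows "sup_const TYPE('n) t a b e * (H x0 - k)
    \<le> (U + r powr t * V) powr (a / t) / r powr a * X powr (b / 2) * measure lborel A powr e"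
proof (cases "k < H x0")
  case False
  then have "sup_const TYPE('n) t a b e * (H x0 - k) \<le> 0"
    using sup_const_pos[OF t, of a b e] by (intro mult_nonneg_nonpos) auto
  also have "0 \<le> (U + r powr t * V) powr (a / t) / r powr a * X powr (b / 2) * measure lborel A powr e"
    by simp
  finally show ?thesis .
next
  case above: True
  let ?N = "CARD('n)" and ?B = "ball y r"
  define \<alpha> where "\<alpha> = 1 - real ?N / t"
  define C where "C = 2 * morrey_const TYPE('n) t"
  define M where "M = H x0 - k"
  define \<omega> where "\<omega> = measure lborel (ball (0::real^'n) 1)"
  have M: "0 < M" using above by (simp add: M_def)
  have t0: "0 < t" using t by (meson of_nat_0_le_iff order_le_less_trans)
  have \<alpha>: "0 < \<alpha>" using t t0 by (simp add: \<alpha>_def)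
  have C: "0 < C" using morrey_const_pos[OF t] by (simp add: C_def)
  have \<omega>: "0 < \<omega>" unfolding \<omega>_def using content_ball_pos[of 1 "0::real^'n"] by simp
  have A_open: "open A"
  proof -
    have "A = ?B \<inter> H -` {k<..}" by (auto simp: A_def)
    then show ?thesis
      using continuous_open_preimage[OF H(1) open_ball open_greaterThan] by simp
  qed
  have A_sub: "A \<subseteq> ?B" by (auto simp: A_def)
  have [measurable]: "A \<in> sets borel" using A_open by auto
  have osc: "\<bar>H x - H z\<bar> \<le> C * s powr \<alpha> * \<Gamma>"
    if "0 < \<Gamma>" "0 < s" "ball z s \<subseteq> ?B"
      "(LINT x|lborel. indicator (ball z s) x * norm (g x) powr t) \<le> \<Gamma> powr t" "x \<in> ball z s" for \<Gamma> s x z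
    unfolding C_def \<alpha>_def by (rule Morrey_subball[OF w gt t that(1,2,3) H that(4,5)])
  have intg: "integrable lborel (\<lambda>x. indicator S x * norm (g x) powr t)" if "S \<in> sets borel" for S
    using integrable_mult_indicator[OF _ gt, of S] that by simp

  \<comment> \<open>\<open>H\<close> is bounded, so the integrals \<open>U\<close> and \<open>X\<close> are those of integrable functions\<close>
  obtain L where L: "\<And>x. x \<in> ?B \<Longrightarrow> \<bar>H x - k\<bar> \<le> L"
  proof -
    let ?I = "LINT x|lborel. indicator ?B x * norm (g x) powr t"
    have I: "0 \<le> ?I" by (intro integral_nonneg_AE AE_I2) auto
    \<comment> \<open>adding \<open>1\<close> keeps \<open>\<Gamma>\<close> positive when the gradient vanishes\<close>
    define \<Gamma> where "\<Gamma> = (?I + 1) powr (1 / t)"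
    have "\<Gamma> powr t = ?I + 1" using I t0 by (simp add: \<Gamma>_def powr_powr)
    moreover have "0 < \<Gamma>"
      unfolding \<Gamma>_def powr_gt_zero using I by linarith
    ultimately have "\<bar>H x - H y\<bar> \<le> C * r powr \<alpha> * \<Gamma>" if "x \<in> ?B" for x
      using osc[of \<Gamma> r y x] r that by simp
    then have "\<bar>H x - k\<bar> \<le> C * r powr \<alpha> * \<Gamma> + \<bar>H y - k\<bar>" if "x \<in> ?B" for x
      using that by (smt (verit))
    then show ?thesis by (rule that)
  qed
  have contU: "continuous_on A (\<lambda>x. \<bar>H x - k\<bar> powr t)"
    using continuous_on_subset[OF H(1) A_sub] t0
    by (intro continuous_intros) (auto simp: A_def)
  have contX: "continuous_on A (\<lambda>x. (H x - k)\<^sup>2)"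
    using continuous_on_subset[OF H(1) A_sub] by (intro continuous_intros) auto

  have lower_U: "m powr t * (\<omega> * s ^ ?N) \<le> U"
    if "0 < m" "0 < s" "ball x0 s \<subseteq> A" "\<And>x. x \<in> ball x0 s \<Longrightarrow> m \<le> H x - k" for m s
    unfolding U_def \<omega>_def
  proof (rule integral_indicator_ge[OF A_open A_sub contU _ that(3,2)])
    show "0 \<le> \<bar>H x - k\<bar> powr t \<and> \<bar>H x - k\<bar> powr t \<le> L powr t" if "x \<in> A" for x
      using L[of x] A_sub that t0 by (auto intro!: powr_mono2)
    show "m powr t \<le> \<bar>H x - k\<bar> powr t" if "x \<in> ball x0 s" for x
      using \<open>0 < m\<close> t0 \<open>\<And>x. x \<in> ball x0 s \<Longrightarrow> m \<le> H x - k\<close>[OF that] by (intro powr_mono2) auto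
  qed
  have lower_X: "m\<^sup>2 * (\<omega> * s ^ ?N) \<le> X"
    if "0 < m" "0 < s" "ball x0 s \<subseteq> A" "\<And>x. x \<in> ball x0 s \<Longrightarrow> m \<le> H x - k" for m s
    unfolding X_def \<omega>_def
  proof (rule integral_indicator_ge[OF A_open A_sub contX _ that(3,2)])
    show "0 \<le> (H x - k)\<^sup>2 \<and> (H x - k)\<^sup>2 \<le> L\<^sup>2" if "x \<in> A" for x
      using L[of x] A_sub that by (auto intro!: abs_le_square_iff[THEN iffD1])
    show "m\<^sup>2 \<le> (H x - k)\<^sup>2" if "x \<in> ball x0 s" for x
      using \<open>0 < m\<close> \<open>\<And>x. x \<in> ball x0 s \<Longrightarrow> m \<le> H x - k\<close>[OF that] by (intro power_mono) auto
  qed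
  have lower_A: "\<omega> * s ^ ?N \<le> measure lborel A" if "0 < s" "ball x0 s \<subseteq> A" for s
  proof -
    have "1 * (\<omega> * s ^ ?N) \<le> (LINT x|lborel. indicator A x * 1)"
      unfolding \<omega>_def
      by (rule integral_indicator_ge[OF A_open A_sub _ _ that(2,1), where L = 1]) auto
    then show ?thesis by simp
  qed

  have x0A: "x0 \<in> A"
  proof -
    have "x0 \<in> ?B" using x0 r subset_ball[of "r / 2" r y] by auto
    then show ?thesis using above by (simp add: A_def)
  qed
  have V0: "0 \<le> V" unfolding V_def by (intro integral_nonneg_AE AE_I2) auto
  have U0: "0 < U"
  proof -
    have "open {x \<in> A. M / 2 < H x - k}"
    proof -
      have "{x \<in> A. M / 2 < H x - k} = A \<inter> H -` {M / 2 + k<..}" by auto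
      then show ?thesis
        using continuous_open_preimage[OF continuous_on_subset[OF H(1) A_sub] A_open open_greaterThan]
        by simp
    qed
    moreover have "x0 \<in> {x \<in> A. M / 2 < H x - k}"
      using x0A M by (simp add: M_def)
    ultimately obtain s where s: "0 < s" "ball x0 s \<subseteq> {x \<in> A. M / 2 < H x - k}"
      using openE by blast
    have "0 < (M / 2) powr t * (\<omega> * s ^ ?N)" using M \<omega> s by simp
    also have "\<dots> \<le> U" using s M by (intro lower_U) (auto simp: subset_iff intro: less_imp_le)
    finally show ?thesis .
  qed

  define W where "W = U + r powr t * V"
  \<comment> \<open>The \<open>t\<close>-norm of the gradient over \<open>A\<close> is at most \<open>\<Gamma>\<close>; the summand \<open>U\<close> of \<open>W\<close> makes \<open>\<Gamma>\<close> positive and is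
    needed when \<open>\<rho>\<close> is \<open>r / 2\<close>.\<close>
  define \<Gamma> where "\<Gamma> = W powr (1 / t) / r"
  have W: "0 < W" using U0 V0 r by (simp add: W_def add_pos_nonneg)
  have \<Gamma>: "0 < \<Gamma>" using W r by (simp add: \<Gamma>_def)
  have \<Gamma>t: "\<Gamma> powr t = W / r powr t"
    using W r t0 by (simp add: \<Gamma>_def powr_divide powr_powr)
  have V\<Gamma>: "V \<le> \<Gamma> powr t"
    using U0 r by (simp add: \<Gamma>t W_def pos_le_divide_eq mult.commute)
  have osc0: "\<bar>H x - H x0\<bar> \<le> C * \<Gamma> * s powr \<alpha>"
    if s: "0 < s" "ball x0 s \<subseteq> A" and x: "x \<in> ball x0 s" for s x
  proof -
    have "(LINT x|lborel. indicator (ball x0 s) x * norm (g x) powr t) \<le> V"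
      unfolding V_def using s by (intro integral_mono intg) (auto simp: indicator_def)
    then have "(LINT x|lborel. indicator (ball x0 s) x * norm (g x) powr t) \<le> \<Gamma> powr t"
      using V\<Gamma> by simp
    from osc[OF \<Gamma> s(1) _ this x] s(2) A_sub show ?thesis by (simp add: mult_ac)
  qed

  \<comment> \<open>the largest radius up to \<open>r / 2\<close> for which the Morrey bound is at most \<open>M / 2\<close>\<close>
  define \<rho> where "\<rho> = (if 2 * (C * \<Gamma> * (r / 2) powr \<alpha>) \<le> M then r / 2 else (M / (2 * C * \<Gamma>)) powr (1 / \<alpha>))"
  have \<rho>0: "0 < \<rho>" using r M C \<Gamma> by (simp add: \<rho>_def)
  have \<rho>\<alpha>: "2 * (C * \<Gamma> * \<rho> powr \<alpha>) \<le> M"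
    using M C \<Gamma> \<alpha> by (auto simp: \<rho>_def powr_powr)
  have \<rho>r: "\<rho> \<le> r / 2"
  proof (cases "2 * (C * \<Gamma> * (r / 2) powr \<alpha>) \<le> M")
    case False
    then have "M / (2 * C * \<Gamma>) \<le> (r / 2) powr \<alpha>"
      using C \<Gamma> by (simp add: pos_divide_le_eq mult_ac)
    then have "(M / (2 * C * \<Gamma>)) powr (1 / \<alpha>) \<le> ((r / 2) powr \<alpha>) powr (1 / \<alpha>)"
      using M C \<Gamma> \<alpha> by (intro powr_mono2) auto
    then show ?thesis using False r \<alpha> by (simp add: \<rho>_def powr_powr)
  qed (simp add: \<rho>_def)
  have \<rho>B: "ball x0 \<rho> \<subseteq> ?B"
  proof
    fix x assume "x \<in> ball x0 \<rho>"
    then show "x \<in> ?B" using x0 \<rho>r dist_triangle[of y x x0] by (simp add: mem_ball)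
  qed
  have \<rho>A: "ball x0 \<rho> \<subseteq> A"
    unfolding A_def
    by (rule ball_above_level[OF H(1) \<rho>B \<alpha> osc0[unfolded A_def]])
       (use C \<Gamma> \<rho>\<alpha> above M_def in auto)
  have half: "M / 2 \<le> H x - k" if "x \<in> ball x0 \<rho>" for x
  proof -
    have "2 * \<bar>H x - H x0\<bar> \<le> M"
      using order_trans[OF mult_left_mono[OF osc0[OF \<rho>0 \<rho>A that], of 2] \<rho>\<alpha>] by simp
    then have "2 * (H x0 - H x) \<le> M"
      using abs_ge_minus_self[of "H x - H x0"] by simp
    then show ?thesis by (simp add: M_def field_simps)
  qed
  have \<rho>N: "\<rho> ^ ?N = \<rho> powr real ?N" using \<rho>0 by (simp add: powr_realpow)

  have growth: "growth_const TYPE('n) t * M \<le> \<rho> powr \<alpha> * \<Gamma>"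
  proof (cases "2 * (C * \<Gamma> * (r / 2) powr \<alpha>) \<le> M")
    case True
    then have \<rho>: "\<rho> = r / 2" by (simp add: \<rho>_def)
    have "(M / 2) powr t * (\<omega> * \<rho> ^ ?N) \<le> U"
      using M by (intro lower_U \<rho>0 \<rho>A half) auto
    also have "U \<le> W" using V0 r by (simp add: W_def)
    finally have "((M / 2) powr t * (\<omega> * \<rho> powr real ?N)) powr (1 / t) \<le> W powr (1 / t)"
      unfolding \<rho>N using M \<omega> t0 by (intro powr_mono2) auto
    moreover have "((M / 2) powr t * (\<omega> * \<rho> powr real ?N)) powr (1 / t)
        = (M / 2) * (\<omega> powr (1 / t) * \<rho> powr (real ?N / t))"
      using M \<omega> t0 by (simp add: powr_mult powr_powr del: power_divide)
    ultimately have "(M / 2) * (\<omega> powr (1 / t) * \<rho> powr (real ?N / t)) \<le> r * \<Gamma>"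
      using r by (simp add: \<Gamma>_def)
    then have "\<rho> powr \<alpha> * ((M / 2) * (\<omega> powr (1 / t) * \<rho> powr (real ?N / t))) \<le> \<rho> powr \<alpha> * (r * \<Gamma>)"
      by (intro mult_left_mono) auto
    also have "\<rho> powr \<alpha> * ((M / 2) * (\<omega> powr (1 / t) * \<rho> powr (real ?N / t)))
        = (M / 2) * \<omega> powr (1 / t) * (\<rho> powr \<alpha> * \<rho> powr (real ?N / t))"
      by (simp only: mult_ac)
    also have "\<rho> powr \<alpha> * \<rho> powr (real ?N / t) = r / 2"
      using r \<rho> by (simp add: \<alpha>_def flip: powr_add)
    finally have "r * (\<omega> powr (1 / t) / 4 * M) \<le> r * (\<rho> powr \<alpha> * \<Gamma>)"
      by (simp add: mult_ac)
    then have "\<omega> powr (1 / t) / 4 * M \<le> \<rho> powr \<alpha> * \<Gamma>"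
      using r by (simp only: mult_le_cancel_left_pos)
    moreover have "growth_const TYPE('n) t * M \<le> \<omega> powr (1 / t) / 4 * M"
      using M by (intro mult_right_mono) (auto simp: growth_const_def \<omega>_def)
    ultimately show ?thesis by linarith
  next
    case False
    then have "\<rho> powr \<alpha> = M / (2 * C * \<Gamma>)"
      using M C \<Gamma> \<alpha> by (simp add: \<rho>_def powr_powr)
    then have "\<rho> powr \<alpha> * \<Gamma> = 1 / (4 * morrey_const TYPE('n) t) * M"
      using \<Gamma> by (simp add: C_def)
    moreover have "growth_const TYPE('n) t * M \<le> 1 / (4 * morrey_const TYPE('n) t) * M"
      using M by (intro mult_right_mono) (auto simp: growth_const_def)
    ultimately show ?thesis by linarith
  qed

  have "growth_const TYPE('n) t powr a * (1 / 2) powr b * \<omega> powr (b / 2 + e) * M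
      \<le> \<Gamma> powr a * X powr (b / 2) * measure lborel A powr e"
  proof (rule interpolation_lower_bound[OF M \<rho>0 \<Gamma> \<omega> growth_const_pos[OF t] growth abe(1-4) abe(5)[folded \<alpha>_def]])
    show "(M / 2)\<^sup>2 * (\<omega> * \<rho> powr real ?N) \<le> X"
      unfolding \<rho>N[symmetric] using M by (intro lower_X \<rho>0 \<rho>A half) auto
    show "\<omega> * \<rho> powr real ?N \<le> measure lborel A"
      unfolding \<rho>N[symmetric] by (rule lower_A[OF \<rho>0 \<rho>A])
  qed
  moreover have "\<Gamma> powr a = W powr (a / t) / r powr a"
    using W r by (simp add: \<Gamma>_def powr_divide powr_powr)
  ultimately show ?thesis
    by (simp add: M_def W_def sup_const_def \<omega>_def)
qed

section \<open>Localization and uniqueness of weak gradients\<close>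

lemma test_function_grad_continuous:
  assumes "test_function S \<phi>" "\<And>x. GDERIV \<phi> x :> \<phi>' x"
  shows "continuous_on UNIV (\<lambda>x. \<phi>' x $ i)"
proof -
  have "Ck (Suc 0) \<phi>" using assms(1) by (simp add: test_function_def del: Ck.simps)
  then obtain D where D: "\<And>x. GDERIV \<phi> x :> D x" "\<And>i. continuous_on UNIV (\<lambda>x. D x $ i)"
    unfolding Ck.simps by blast
  have "\<phi>' x = D x" for x
  proof -
    have "(\<lambda>h. h \<bullet> \<phi>' x) = (\<lambda>h. h \<bullet> D x)"
      using assms(2)[of x] D(1)[of x] unfolding gderiv_def by (rule has_derivative_unique)
    then show ?thesis by (metis inner_commute vector_eq_ldot)
  qed
  then show ?thesis using D(2) by simp
qed

text \<open>The kernels are test functions, so all cone averages of the components of \<open>g - g'\<close> vanish; these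
  averages converge to the components themselves.\<close>

lemma weak_gradient_ball_unique:
  fixes c :: "real^'n::finite"
  assumes w: "weak_gradient_ball c (2 * R) f g" and w': "weak_gradient_ball c (2 * R) f' g'"
    and R: "0 < R" and ff': "AE x in lborel. f x = f' x"
  shows "AE x in lborel. g x = g' x"
proof -
  let ?B = "ball c (2 * R)"
  have f [measurable]: "f \<in> borel_measurable borel" "f' \<in> borel_measurable borel"
    and g: "integrable lborel g" "integrable lborel g'"
    and out: "\<And>x. x \<notin> ?B \<Longrightarrow> g x = 0" "\<And>x. x \<notin> ?B \<Longrightarrow> g' x = 0"
    using w w' by (auto simp: weak_gradient_ball_def)
  have gi: "integrable lborel (\<lambda>x. g x $ i)" "integrable lborel (\<lambda>x. g' x $ i)" for i
    using integrable_inner_left[OF g(1), of "axis i 1"] integrable_inner_left[OF g(2), of "axis i 1"]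
    by (simp_all add: inner_axis)
  have "AE x in lborel. g x $ i = g' x $ i" for i
  proof -
    have "AE x in lborel. x \<in> ?B \<longrightarrow> g x $ i - g' x $ i = 0"
    proof (rule cone_average_limit_AE[where K = 0 and L = 0 and \<alpha> = 1 and R = R])
      show "integrable lborel (\<lambda>x. g x $ i - g' x $ i)" using gi by simp
      fix \<sigma> :: real and z
      assume A: "0 < \<sigma>" "\<sigma> \<le> 1" "z \<in> ?B"
      let ?k = "cone_kernel c R z \<sigma>"
      have T: "test_function ?B ?k"
        using test_function_cone_kernel_mult[OF A(1,2) R A(3) Ck_const[of _ 1]] by simp
      define k' where "k' x = (1 / (\<sigma> * R)) ^ Suc CARD('n) *\<^sub>R mollifier_grad (cone_arg c R z \<sigma> x)" for x
      have k': "GDERIV ?k x :> k' x" for x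
        unfolding k'_def by (rule GDERIV_cone_kernel)
      have [measurable]: "(\<lambda>x. k' x $ i) \<in> borel_measurable borel"
        by (rule borel_measurable_continuous_onI[OF test_function_grad_continuous[OF T k']])
      have "(LINT x|lborel. ?k x * g x $ i) = - (LINT x|lborel. k' x $ i * f x)"
        using weak_gradient_ballD[OF w T k', of i] by simp
      also have "(LINT x|lborel. k' x $ i * f x) = (LINT x|lborel. k' x $ i * f' x)"
        using ff' by (intro integral_cong_AE) auto
      also have "- \<dots> = (LINT x|lborel. ?k x * g' x $ i)"
        using weak_gradient_ballD[OF w' T k', of i] by simp
      finally have "cone_average c R (\<lambda>x. g x $ i - g' x $ i) z \<sigma> = 0"
        using integrable_continuous_mult[OF gi(1) _ continuous_on_cone_kernel, of c "2 * R" i c R z \<sigma>]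
          integrable_continuous_mult[OF gi(2) _ continuous_on_cone_kernel, of c "2 * R" i c R z \<sigma>] out
        by (simp add: cone_average_def right_diff_distrib)
      then show "\<bar>cone_average c R (\<lambda>x. g x $ i - g' x $ i) z \<sigma> - 0\<bar> \<le> 0 * \<sigma> powr 1" by simp
    qed (use R in auto)
    then show ?thesis
      by eventually_elim (use out in fastforce)
  qed
  then have "AE x in lborel. \<forall>i\<in>UNIV. g x $ i = g' x $ i"
    by (intro AE_finite_allI) auto
  then show ?thesis by eventually_elim (simp add: vec_eq_iff)
qed

lemma borel_representative_ball:
  fixes v :: "real^'n::finite \<Rightarrow> real"
  assumes v: "integrable lebesgue (\<lambda>x. indicator (ball y r) x * v x)"
  obtains f where "integrable lborel f" "\<And>x. x \<notin> ball y r \<Longrightarrow> f x = 0"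
    "AE x in lebesgue. indicator (ball y r) x * v x = f x"
proof -
  obtain f0 where f0 [measurable]: "f0 \<in> borel_measurable borel"
    and ae: "AE x in lborel. indicator (ball y r) x * v x = f0 x"
    using completion_ex_borel_measurable_real[of "\<lambda>x. indicator (ball y r) x * v x" lborel] v by auto
  define f where "f x = indicator (ball y r) x * f0 x" for x
  have [measurable]: "f \<in> borel_measurable borel"
    unfolding f_def[abs_def] by (intro borel_measurable_times borel_measurable_indicator f0) simp
  have "AE x in lborel. indicator (ball y r) x * v x = f x"
    using ae by eventually_elim (auto simp: f_def indicator_def)
  then have ae': "AE x in lebesgue. indicator (ball y r) x * v x = f x"
    by (rule AE_completion)
  have fm: "f \<in> borel_measurable lebesgue" by (intro measurable_completion) simp
  have "integrable lebesgue f"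
    by (rule integrable_cong_AE_imp[OF v fm]) (use ae' in eventually_elim, simp)
  then have "integrable lborel f" by (simp add: integrable_completion)
  then show ?thesis using ae' by (intro that[of f]) (auto simp: f_def)
qed

text \<open>Test functions of the ball and their gradients vanish outside it, so in the defining identity the
  functions may be cut off there and replaced by Borel functions almost everywhere equal to them.\<close>

lemma weak_gradient_localize:
  fixes u :: "real^'n::finite \<Rightarrow> real"
  assumes w: "weak_gradient \<Omega> u g" and \<Omega>: "open \<Omega>" and sub: "cball y r \<subseteq> \<Omega>"
  obtains f G where "weak_gradient_ball y r f G"
    "AE x in lebesgue. indicator (ball y r) x * u x = f x"
    "AE x in lebesgue. indicator (ball y r) x *\<^sub>R g x = G x"
proof -
  let ?B = "ball y r"
  have BS: "?B \<subseteq> \<Omega>" using sub ball_subset_cball by blast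
  have loc: "integrable lebesgue (\<lambda>x. indicator ?B x *\<^sub>R v x)"
    if "v locally_integrable_on \<Omega>" for v :: "real^'n \<Rightarrow> 'b::euclidean_space"
  proof -
    have "integrable (lebesgue_on (cball y r)) v"
      using that sub by (simp add: locally_integrable_on_def)
    then have "integrable lebesgue (\<lambda>x. indicator (cball y r) x *\<^sub>R v x)"
      by (rule iffD1[OF integrable_restrict_space, rotated]) simp
    then have "integrable lebesgue (\<lambda>x. indicator ?B x *\<^sub>R (indicator (cball y r) x *\<^sub>R v x))"
      by (rule integrable_mult_indicator[rotated]) simp
    moreover have "indicator ?B x *\<^sub>R (indicator (cball y r) x *\<^sub>R v x) = indicator ?B x *\<^sub>R v x" for x
      by (auto simp: indicator_def)
    ultimately show ?thesis by (simp only:)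
  qed
  have u: "integrable lebesgue (\<lambda>x. indicator ?B x * u x)"
    using loc[of u] w by (simp add: weak_gradient_def)
  have "integrable lebesgue (\<lambda>x. indicator ?B x *\<^sub>R g x)"
    using loc[of g] w by (simp add: weak_gradient_def)
  from integrable_inner_left[OF this, of "axis _ 1"]
  have gi: "integrable lebesgue (\<lambda>x. indicator ?B x * g x $ i)" for i
    by (simp add: inner_axis)
  obtain f where f: "integrable lborel f" "\<And>x. x \<notin> ?B \<Longrightarrow> f x = 0"
    and uf: "AE x in lebesgue. indicator ?B x * u x = f x"
    using borel_representative_ball[OF u] by blast
  have "\<forall>i. \<exists>f. integrable lborel f \<and> (\<forall>x. x \<notin> ?B \<longrightarrow> f x = 0) \<and>
      (AE x in lebesgue. indicator ?B x * g x $ i = f x)"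
    by (rule allI, rule borel_representative_ball[OF gi]) blast
  from choice[OF this] obtain F where "\<forall>i. integrable lborel (F i) \<and> (\<forall>x. x \<notin> ?B \<longrightarrow> F i x = 0) \<and>
      (AE x in lebesgue. indicator ?B x * g x $ i = F i x)"
    by (rule exE)
  then have F: "integrable lborel (F i)" "x \<notin> ?B \<Longrightarrow> F i x = 0"
    and gF: "AE x in lebesgue. indicator ?B x * g x $ i = F i x" for i x
    by simp_all
  define G where "G x = (\<chi> i. F i x)" for x
  have G_sum: "G = (\<lambda>x. \<Sum>i\<in>UNIV. F i x *\<^sub>R axis i 1)"
    by (auto simp: G_def fun_eq_iff vec_eq_iff axis_def if_distrib[of "\<lambda>a. _ * a"] sum.delta cong: if_cong)
  have Gint: "integrable lborel G"
    unfolding G_sum using F(1) by (intro Bochner_Integration.integrable_sum integrable_scaleR_left) auto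
  have "AE x in lebesgue. \<forall>i\<in>UNIV. indicator ?B x * g x $ i = F i x"
    using gF by (intro AE_finite_allI) auto
  then have gG: "AE x in lebesgue. indicator ?B x *\<^sub>R g x = G x"
    by eventually_elim (simp add: vec_eq_iff G_def)
  have "weak_gradient_ball y r f G"
    unfolding weak_gradient_ball_def
  proof (intro conjI allI impI f Gint)
    show "G x = 0" if "x \<notin> ?B" for x using F(2)[OF that] by (simp add: G_def vec_eq_iff)
    fix \<phi> \<phi>' i
    assume A: "test_function ?B \<phi> \<and> (\<forall>x. GDERIV \<phi> x :> \<phi>' x)"
    then have T: "test_function ?B \<phi>" and D: "\<And>x. GDERIV \<phi> x :> \<phi>' x" by auto
    have [measurable]: "(\<lambda>x. \<phi>' x $ i) \<in> borel_measurable borel"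
      by (rule borel_measurable_continuous_onI[OF test_function_grad_continuous[OF T D]])
    have "Ck 0 \<phi>" using T unfolding test_function_def by blast
    then have [measurable]: "\<phi> \<in> borel_measurable borel"
      by (intro borel_measurable_continuous_onI) simp
    have to_lborel: "(LINT x|lebesgue_on \<Omega>. v x * h x) = (LINT x|lborel. h x * f x)"
      if h: "h \<in> borel_measurable borel" "\<And>x. x \<notin> ?B \<Longrightarrow> h x = 0" and f: "integrable lborel f"
        and v: "integrable lebesgue (\<lambda>x. indicator ?B x * v x)"
        and vf: "AE x in lebesgue. indicator ?B x * v x = f x" for v h f :: "real^'n \<Rightarrow> real"
    proof -
      have "(LINT x|lebesgue_on \<Omega>. v x * h x) = (LINT x|lebesgue. indicator \<Omega> x *\<^sub>R (v x * h x))"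
        using \<Omega> by (intro integral_restrict_space) auto
      also have "\<dots> = (LINT x|lebesgue. h x * (indicator ?B x * v x))"
        using h(2) BS by (intro Bochner_Integration.integral_cong) (auto simp: indicator_def)
      also have "\<dots> = (LINT x|lebesgue. h x * f x)"
      proof (rule integral_cong_AE)
        have hm: "h \<in> borel_measurable lebesgue" "f \<in> borel_measurable lebesgue"
          using h f by (auto intro!: measurable_completion)
        show "(\<lambda>x. h x * (indicator ?B x * v x)) \<in> borel_measurable lebesgue"
          by (rule borel_measurable_times[OF hm(1) borel_measurable_integrable[OF v]])
        show "(\<lambda>x. h x * f x) \<in> borel_measurable lebesgue"
          by (rule borel_measurable_times[OF hm])
        show "AE x in lebesgue. h x * (indicator ?B x * v x) = h x * f x"
          using vf by eventually_elim simp
      qed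
      also have "\<dots> = (LINT x|lborel. h x * f x)"
        using f h by (intro integral_completion) auto
      finally show ?thesis .
    qed
    have "(LINT x|lborel. \<phi>' x $ i * f x) = (LINT x|lebesgue_on \<Omega>. u x * \<phi>' x $ i)"
      using test_function_grad_eq_0[OF T D]
      by (intro to_lborel[symmetric] f u uf) auto
    also have "\<dots> = - (LINT x|lebesgue_on \<Omega>. g x $ i * \<phi> x)"
      using w D test_function_mono[OF T BS] unfolding weak_gradient_def by blast
    also have "(LINT x|lebesgue_on \<Omega>. g x $ i * \<phi> x) = (LINT x|lborel. \<phi> x * F i x)"
      using test_function_eq_0[OF T] by (intro to_lborel F gi gF) auto
    finally show "(LINT x|lborel. \<phi>' x $ i * f x) = - (LINT x|lborel. \<phi> x * G x $ i)"
      by (simp add: G_def)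
  qed
  then show ?thesis using uf gG by (rule that)
qed

lemma integral_lebesgue_on_eq_lborel:
  fixes F :: "real^'n::finite \<Rightarrow> real"
  assumes S: "S \<in> sets lebesgue" and \<psi>: "(\<lambda>x. indicator S x * \<psi> x) \<in> borel_measurable lebesgue"
    and F: "F \<in> borel_measurable borel" and ae: "AE x in lebesgue. indicator S x * \<psi> x = F x"
  shows "(LINT x|lebesgue_on S. \<psi> x) = (LINT x|lborel. F x)"
proof -
  have "(LINT x|lebesgue_on S. \<psi> x) = (LINT x|lebesgue. indicator S x *\<^sub>R \<psi> x)"
    using S by (intro integral_restrict_space) auto
  also have "\<dots> = (LINT x|lebesgue. F x)"
    unfolding real_scaleR_def by (rule integral_cong_AE[OF \<psi> measurable_completion ae]) (simp add: F)
  also have "\<dots> = (LINT x|lborel. F x)"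
    using F by (intro integral_completion) auto
  finally show ?thesis .
qed

section \<open>The supremum bound for Sobolev functions\<close>

text \<open>A connected set that meets both \<open>\<Omega>\<close> and its complement meets the frontier.\<close>

lemma cball_subset_if_less_infdist_frontier:
  fixes y :: "'a::euclidean_space"
  assumes "y \<in> \<Omega>" "0 < r" "r < infdist y (frontier \<Omega>)"
  shows "cball y r \<subseteq> \<Omega>"
proof (rule ccontr)
  assume "\<not> cball y r \<subseteq> \<Omega>"
  moreover have "y \<in> cball y r \<inter> \<Omega>" using assms by simp
  ultimately have "cball y r \<inter> frontier \<Omega> \<noteq> {}"
    using connected_Int_frontier[OF convex_connected[OF convex_cball], of y r \<Omega>] by blast
  then obtain w where "w \<in> frontier \<Omega>" "dist y w \<le> r" by auto
  then show False using infdist_le[of w "frontier \<Omega>" y] assms(3) by simp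
qed

text \<open>The parameter \<open>q\<close> cancels: \<open>\<beta> = (p - 1) / p * (1 + 2 / N - 2 / t)\<close>. The last two identities say
  that the bound is homogeneous of degree \<open>1\<close> in \<open>u - k\<close> and invariant under dilations of the ball.
  With \<open>y = \<eta> / \<xi>\<close>, so that \<open>\<theta> = 1 / p + y\<close> and \<open>\<beta> = \<theta> * y\<close>, the second one reduces to
  \<open>(\<theta> - 1) * (1 + y) = \<beta> - (p - 1) / p\<close>.\<close>

lemma exponent_identities:
  fixes N p q t s sstar \<beta> \<theta> \<xi> \<eta> :: real
  assumes N: "2 \<le> N" and p: "1 < p" and t: "N < t" and \<xi>: "0 < \<xi>" and \<eta>: "0 < \<eta>"
    and q: "2 < q" "q < 2 * p"
    and s: "s = 2 * q * N * (p - 1) / (N * (2 * p - q) + 2 * q * (p - 1))"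
    and sstar: "sstar = N * s / (N - s)"
    and \<beta>: "\<beta> = 1 - 2 / q + (1 - s / t) * (sstar / s) * ((2 * p - q) / (p * q))"
    and sys: "\<xi> / p + \<eta> = \<theta> * \<xi>" "\<beta> * \<xi> = \<theta> * \<eta>"
  shows "\<theta> = 1 / p + \<eta> / \<xi>" "1 < \<theta>"
    "\<xi> * (p - 1) / (\<eta> * p) + \<xi> * (\<theta> - 1) / \<eta> = 1"
    "N * (\<xi> * (\<theta> - 1) / \<eta> / 2 + (\<theta> - 1) / 2) = \<xi> * (p - 1) / (\<eta> * p) * (1 - N / t)"
proof -
  define D where "D = N * (2 * p - q) + 2 * q * (p - 1)"
  define E where "E = 2 * p - q"
  have E: "0 < E" using q by (simp add: E_def)
  have D_E: "D = N * E + 2 * q * (p - 1)" by (simp add: D_def E_def)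
  have D: "0 < D" unfolding D_E using N E p q by (intro add_pos_pos mult_pos_pos) auto
  have s': "s = 2 * q * N * (p - 1) / D" by (simp add: s D_def)
  have s0: "0 < s" unfolding s' using N p q D by (intro divide_pos_pos mult_pos_pos) auto
  have Ns: "N - s = N * N * E / D"
  proof -
    have "N - s = (N * D - 2 * q * N * (p - 1)) / D"
      using D by (simp add: s' diff_divide_distrib)
    also have "N * D - 2 * q * N * (p - 1) = N * N * E" by (simp add: D_E algebra_simps)
    finally show ?thesis .
  qed
  have ratio: "sstar / s = D / (N * E)"
    using N s0 D E by (simp add: sstar Ns)
  have "s * D = 2 * q * N * (p - 1)" using D by (simp add: s')
  moreover have "(1 - s / t) * (sstar / s) = D / (N * E) - s * D / (t * (N * E))"
    unfolding ratio by (simp only: left_diff_distrib mult_1_left times_divide_times_eq)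
  ultimately have "(1 - s / t) * (sstar / s) = D / (N * E) - 2 * q * N * (p - 1) / (t * (N * E))"
    by (simp only:)
  also have "2 * q * N * (p - 1) / (t * (N * E)) = 2 * q * (p - 1) / (t * E)"
    using N by simp
  finally have "(1 - s / t) * (sstar / s) = D / (N * E) - 2 * q * (p - 1) / (t * E)" .
  then have "(1 - s / t) * (sstar / s) * (E / (p * q))
      = D / (N * E) * (E / (p * q)) - 2 * q * (p - 1) / (t * E) * (E / (p * q))"
    by (simp only: left_diff_distrib[of "D / (N * E)"])
  also have "\<dots> = D / (N * p * q) - 2 * (p - 1) / (t * p)"
  proof -
    have "D / (N * E) * (E / (p * q)) = D / (N * p * q)" using E by (simp add: mult.assoc)
    moreover have "2 * q * (p - 1) / (t * E) * (E / (p * q)) = 2 * (p - 1) / (t * p)"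
      using E q p N t by (simp add: field_simps)
    ultimately show ?thesis by (simp only:)
  qed
  also have "D / (N * p * q) = 2 / q - 1 / p + 2 * (p - 1) / (N * p)"
    unfolding D_E E_def using N p q by (simp add: field_simps)
  finally have \<beta>1: "\<beta> = 1 - 1 / p + 2 * (p - 1) / (N * p) - 2 * (p - 1) / (t * p)"
    by (simp add: \<beta> E_def)
  have \<beta>': "\<beta> = (p - 1) / p * (1 + 2 / N - 2 / t)"
  proof -
    have "1 - 1 / p = (p - 1) / p" using p by (simp add: diff_divide_distrib)
    moreover have "2 * (p - 1) / (N * p) = (p - 1) / p * (2 / N)" by (simp add: mult.commute)
    moreover have "2 * (p - 1) / (t * p) = (p - 1) / p * (2 / t)" by (simp add: mult.commute)
    ultimately have "\<beta> = (p - 1) / p + (p - 1) / p * (2 / N) - (p - 1) / p * (2 / t)"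
      using \<beta>1 by (simp only:)
    then show ?thesis by (simp only: distrib_left right_diff_distrib mult_1_right)
  qed
  show \<theta>: "\<theta> = 1 / p + \<eta> / \<xi>" using sys(1) \<xi> by (simp add: field_simps)
  define y where "y = \<eta> / \<xi>"
  have y: "0 < y" "\<theta> = 1 / p + y" using \<xi> \<eta> \<theta> by (auto simp: y_def)
  have \<beta>y: "\<beta> = \<theta> * y" using sys(2) \<xi> by (simp add: y_def field_simps)
  have "2 / t < 2 / N" using N t by (intro divide_strict_left_mono) auto
  then have "(p - 1) / p * 1 < \<beta>" unfolding \<beta>' using p by (intro mult_strict_left_mono) auto
  then have big: "1 - 1 / p < \<theta> * y" using p by (simp add: \<beta>y diff_divide_distrib)
  show "1 < \<theta>"
  proof (rule ccontr)
    assume "\<not> 1 < \<theta>"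
    then have "\<theta> * y \<le> 1 * (1 - 1 / p)" using y p by (intro mult_mono) auto
    with big show False by simp
  qed
  have inv: "\<xi> / \<eta> = 1 / y" by (simp add: y_def)
  show "\<xi> * (p - 1) / (\<eta> * p) + \<xi> * (\<theta> - 1) / \<eta> = 1"
  proof -
    have "\<xi> * (p - 1) / (\<eta> * p) + \<xi> * (\<theta> - 1) / \<eta> = (\<xi> / \<eta>) * ((p - 1) / p + (\<theta> - 1))"
      by (simp add: distrib_left)
    also have "(p - 1) / p + (\<theta> - 1) = y" using p by (simp add: y diff_divide_distrib)
    finally show ?thesis using y by (simp add: inv)
  qed
  show "N * (\<xi> * (\<theta> - 1) / \<eta> / 2 + (\<theta> - 1) / 2) = \<xi> * (p - 1) / (\<eta> * p) * (1 - N / t)"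
  proof -
    have "(\<theta> - 1) * (1 + y) = \<theta> * y + (\<theta> - y) - 1" by (simp add: algebra_simps)
    also have "\<dots> = \<beta> - (p - 1) / p" using p by (simp add: \<beta>y y diff_divide_distrib)
    also have "\<dots> = (p - 1) / p * (2 / N - 2 / t)" by (simp add: \<beta>' algebra_simps)
    finally have key: "(\<theta> - 1) * (1 + y) = (p - 1) / p * (2 / N - 2 / t)" .
    have "N * (\<xi> * (\<theta> - 1) / \<eta> / 2 + (\<theta> - 1) / 2) = N / 2 * (\<theta> - 1) * (\<xi> / \<eta> + 1)"
      using \<eta> by (simp add: field_simps)
    also have "\<xi> / \<eta> + 1 = (1 + y) / y" using y by (simp add: inv field_simps)
    also have "N / 2 * (\<theta> - 1) * ((1 + y) / y) = N / 2 * ((\<theta> - 1) * (1 + y)) * (1 / y)" by simp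
    also have "\<dots> = (1 / y) * ((p - 1) / p) * (N / 2 * (2 / N - 2 / t))"
      unfolding key by (simp only: mult_ac)
    also have "N / 2 * (2 / N - 2 / t) = 1 - N / t" using N by (simp add: right_diff_distrib)
    also have "(1 / y) * ((p - 1) / p) = \<xi> * (p - 1) / (\<eta> * p)" unfolding inv[symmetric] by simp
    finally show ?thesis .
  qed
qed

text \<open>Membership in \<open>W1p\<close> provides some weak gradient \<open>g'\<close> in \<open>Lp\<close>; by uniqueness it agrees with the
  given \<open>g\<close> almost everywhere, so the integral of the powers of \<open>g\<close> is finite. The sets and integrals
  of \<open>u\<close> and \<open>g\<close> may then be replaced by those of the continuous representative \<open>H\<close> and the Borel
  function \<open>G\<close>.\<close>

lemma sup_ball_bound:
  fixes u :: "real^'n::finite \<Rightarrow> real" and g :: "real^'n \<Rightarrow> real^'n" and k :: real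
  assumes t: "real CARD('n) < t" and \<Omega>: "open \<Omega>" and u: "u \<in> W1p t \<Omega>" and w: "weak_gradient \<Omega> u g"
    and r: "0 < r" and sub: "cball y r \<subseteq> \<Omega>"
    and abe: "0 \<le> a" "0 \<le> b" "0 \<le> e" "a + b = 1"
      "real CARD('n) * (b / 2 + e) = a * (1 - real CARD('n) / t)"
  defines "A \<equiv> Aplus u y k r"
  defines "d \<equiv> (1 / sup_const TYPE('n) t a b e) / r powr a
    * ((LINT x|lebesgue_on A. \<bar>u x - k\<bar> powr t)
       + r powr t * (LINT x|lebesgue_on A. norm (g x) powr t)) powr (a / t)
    * (LINT x|lebesgue_on A. \<bar>u x - k\<bar>\<^sup>2) powr (b / 2) * measure lebesgue A powr e"
  shows "sup_ball u y (r / 2) \<le> ereal (k + d)"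
proof -
  let ?B = "ball y r"
  have t0: "0 < t" using t by (meson of_nat_0_le_iff order_le_less_trans)
  have BS: "?B \<subseteq> \<Omega>" using sub ball_subset_cball by blast
  define \<kappa> where "\<kappa> = sup_const TYPE('n) t a b e"
  have \<kappa>: "0 < \<kappa>" unfolding \<kappa>_def by (rule sup_const_pos[OF t])

  obtain f G where wG: "weak_gradient_ball y r f G"
    and uf: "AE x in lebesgue. indicator ?B x * u x = f x"
    and gG: "AE x in lebesgue. indicator ?B x *\<^sub>R g x = G x"
    using weak_gradient_localize[OF w \<Omega> sub] by blast
  obtain g' where w': "weak_gradient \<Omega> u g'" and g': "g' \<in> Lp t \<Omega>"
    using u by (auto simp: W1p_def)
  obtain f' G' where wG': "weak_gradient_ball y r f' G'"
    and uf': "AE x in lebesgue. indicator ?B x * u x = f' x"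
    and gG': "AE x in lebesgue. indicator ?B x *\<^sub>R g' x = G' x"
    using weak_gradient_localize[OF w' \<Omega> sub] by blast
  have f: "integrable lborel f" and G: "integrable lborel G"
    using wG by (auto simp: weak_gradient_ball_def)
  have [measurable]: "f \<in> borel_measurable borel" "G \<in> borel_measurable borel"
    using f G by auto

  have "AE x in lebesgue. f x = f' x"
    using uf uf' by eventually_elim simp
  then have "AE x in lborel. f x = f' x" by (simp add: AE_completion_iff)
  then have "AE x in lborel. G x = G' x"
    using weak_gradient_ball_unique[of y "r / 2" f G f' G'] wG wG' r by simp
  then have "AE x in lebesgue. G x = G' x" by (rule AE_completion)
  then have g'G: "AE x in lebesgue. indicator ?B x *\<^sub>R norm (g' x) powr t = norm (G x) powr t"
    using gG' by eventually_elim (auto simp: indicator_def split: if_splits)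
  have gt: "integrable lborel (\<lambda>x. norm (G x) powr t)"
  proof -
    have "integrable (lebesgue_on \<Omega>) (\<lambda>x. norm (g' x) powr t)"
      using g' by (simp add: Lp_def)
    then have "integrable lebesgue (\<lambda>x. indicator \<Omega> x *\<^sub>R norm (g' x) powr t)"
      using \<Omega> by (intro iffD1[OF integrable_restrict_space, rotated]) auto
    then have "integrable lebesgue (\<lambda>x. indicator ?B x *\<^sub>R (indicator \<Omega> x *\<^sub>R norm (g' x) powr t))"
      by (rule integrable_mult_indicator[rotated]) simp
    moreover have "indicator ?B x *\<^sub>R (indicator \<Omega> x *\<^sub>R norm (g' x) powr t)
        = indicator ?B x *\<^sub>R norm (g' x) powr t" for x
      using BS by (auto simp: indicator_def)
    ultimately have int: "integrable lebesgue (\<lambda>x. indicator ?B x *\<^sub>R norm (g' x) powr t)"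
      by (simp only:)
    have "(\<lambda>x. norm (G x) powr t) \<in> borel_measurable borel" by measurable
    moreover from this have "integrable lebesgue (\<lambda>x. norm (G x) powr t)"
      by (intro integrable_cong_AE_imp[OF int _ g'G] measurable_completion) simp
    ultimately show ?thesis by (simp add: integrable_completion)
  qed

  obtain H where H: "continuous_on ?B H" "AE x in lborel. x \<in> ?B \<longrightarrow> f x = H x"
  proof -
    let ?I = "LINT x|lborel. norm (G x) powr t"
    have I: "0 \<le> ?I" by (intro integral_nonneg_AE AE_I2) auto
    define \<Gamma> where "\<Gamma> = (?I + 1) powr (1 / t)"
    have le: "?I \<le> \<Gamma> powr t" using I t0 by (simp add: \<Gamma>_def powr_powr)
    have \<Gamma>: "0 < \<Gamma>" unfolding \<Gamma>_def powr_gt_zero using I by linarith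
    have "weak_gradient_ball y (2 * (r / 2)) f G" using wG by simp
    from Morrey_ball[OF this gt le t \<Gamma> half_gt_zero[OF r]]
    obtain H m where "continuous_on (ball y (2 * (r / 2))) H"
      "AE x in lborel. x \<in> ball y (2 * (r / 2)) \<longrightarrow> f x = H x"
      by blast
    then show ?thesis using that[of H] by simp
  qed
  have uH: "AE x in lebesgue. x \<in> ?B \<longrightarrow> u x = H x"
    using uf AE_completion[OF H(2)] by eventually_elim auto
  have gG'': "AE x in lebesgue. x \<in> ?B \<longrightarrow> g x = G x"
    using gG by eventually_elim auto

  define AH where "AH = {x \<in> ?B. k < H x}"
  have AH_open: "open AH"
  proof -
    have "AH = ?B \<inter> H -` {k<..}" by (auto simp: AH_def)
    then show ?thesis
      using continuous_open_preimage[OF H(1) open_ball open_greaterThan] by simp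
  qed
  have AH_sub: "AH \<subseteq> ?B" by (auto simp: AH_def)
  have [measurable]: "AH \<in> sets borel" using AH_open by auto
  have AE_A: "AE x in lebesgue. x \<in> A \<longleftrightarrow> x \<in> AH"
    using uH by eventually_elim (auto simp: A_def AH_def Aplus_def)

  define uB where "uB x = indicator ?B x * u x" for x
  define gB where "gB x = indicator ?B x *\<^sub>R g x" for x
  have iB: "(indicator ?B :: real^'n \<Rightarrow> real) \<in> borel_measurable lebesgue"
    by (rule borel_measurable_indicator) simp
  have uB: "uB \<in> borel_measurable lebesgue"
  proof -
    have "u \<in> borel_measurable (lebesgue_on \<Omega>)" using u by (simp add: W1p_def Lp_def)
    then have "(\<lambda>x. indicator \<Omega> x *\<^sub>R u x) \<in> borel_measurable lebesgue"
      using \<Omega> by (subst (asm) borel_measurable_restrict_space_iff) auto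
    then have "(\<lambda>x. indicator ?B x * (indicator \<Omega> x *\<^sub>R u x)) \<in> borel_measurable lebesgue"
      by (rule borel_measurable_times[OF iB])
    moreover have "indicator ?B x * (indicator \<Omega> x *\<^sub>R u x) = uB x" for x
      using BS by (auto simp: indicator_def uB_def)
    ultimately show ?thesis by simp
  qed
  have gB: "gB \<in> borel_measurable lebesgue"
  proof -
    have "integrable (lebesgue_on (cball y r)) g"
      using w sub by (simp add: weak_gradient_def locally_integrable_on_def)
    then have "(\<lambda>x. indicator (cball y r) x *\<^sub>R g x) \<in> borel_measurable lebesgue"
      by (subst borel_measurable_restrict_space_iff[symmetric]) auto
    then have "(\<lambda>x. indicator ?B x *\<^sub>R (indicator (cball y r) x *\<^sub>R g x)) \<in> borel_measurable lebesgue"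
      by (rule borel_measurable_scaleR[OF iB])
    moreover have "indicator ?B x *\<^sub>R (indicator (cball y r) x *\<^sub>R g x) = gB x" for x
      by (auto simp: indicator_def gB_def)
    ultimately show ?thesis by simp
  qed
  have A_eq: "A = ?B \<inter> uB -` {k<..}" by (auto simp: A_def Aplus_def uB_def)
  have A_sets: "A \<in> sets lebesgue"
    unfolding A_eq using measurable_sets[OF uB, of "{k<..}"] by (intro sets.Int) auto
  have iA: "indicator A \<in> borel_measurable lebesgue"
    using A_sets by (intro borel_measurable_indicator)
  have A_sub: "A \<subseteq> ?B" by (auto simp: A_def Aplus_def)

  define U where "U = (LINT x|lborel. indicator AH x * \<bar>H x - k\<bar> powr t)"
  define V where "V = (LINT x|lborel. indicator AH x * norm (G x) powr t)"
  define X where "X = (LINT x|lborel. indicator AH x * (H x - k)\<^sup>2)"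
  have U_eq: "(LINT x|lebesgue_on A. \<bar>u x - k\<bar> powr t) = U"
    unfolding U_def
  proof (rule integral_lebesgue_on_eq_lborel[OF A_sets])
    have "(\<lambda>x. indicator A x * \<bar>uB x - k\<bar> powr t) \<in> borel_measurable lebesgue"
      using iA uB by measurable
    moreover have "indicator A x * \<bar>uB x - k\<bar> powr t = indicator A x * \<bar>u x - k\<bar> powr t" for x
      using A_sub by (auto simp: indicator_def uB_def)
    ultimately show "(\<lambda>x. indicator A x * \<bar>u x - k\<bar> powr t) \<in> borel_measurable lebesgue"
      by (simp only:)
    have "continuous_on AH (\<lambda>x. \<bar>H x - k\<bar> powr t)"
      using continuous_on_subset[OF H(1) AH_sub] t0
      by (intro continuous_intros) (auto simp: AH_def)
    then show "(\<lambda>x. indicator AH x * \<bar>H x - k\<bar> powr t) \<in> borel_measurable borel"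
      using borel_measurable_continuous_on_indicator[of AH "\<lambda>x. \<bar>H x - k\<bar> powr t"] by simp
    show "AE x in lebesgue. indicator A x * \<bar>u x - k\<bar> powr t = indicator AH x * \<bar>H x - k\<bar> powr t"
      using AE_A uH by eventually_elim (use A_sub in \<open>auto simp: indicator_def\<close>)
  qed
  have X_eq: "(LINT x|lebesgue_on A. \<bar>u x - k\<bar>\<^sup>2) = X"
    unfolding X_def
  proof (rule integral_lebesgue_on_eq_lborel[OF A_sets])
    have "(\<lambda>x. indicator A x * \<bar>uB x - k\<bar>\<^sup>2) \<in> borel_measurable lebesgue"
      using iA uB by measurable
    moreover have "indicator A x * \<bar>uB x - k\<bar>\<^sup>2 = indicator A x * \<bar>u x - k\<bar>\<^sup>2" for x
      using A_sub by (auto simp: indicator_def uB_def)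
    ultimately show "(\<lambda>x. indicator A x * \<bar>u x - k\<bar>\<^sup>2) \<in> borel_measurable lebesgue"
      by (simp only:)
    have "continuous_on AH (\<lambda>x. (H x - k)\<^sup>2)"
      using continuous_on_subset[OF H(1) AH_sub] by (intro continuous_intros)
    then show "(\<lambda>x. indicator AH x * (H x - k)\<^sup>2) \<in> borel_measurable borel"
      using borel_measurable_continuous_on_indicator[of AH "\<lambda>x. (H x - k)\<^sup>2"] by simp
    show "AE x in lebesgue. indicator A x * \<bar>u x - k\<bar>\<^sup>2 = indicator AH x * (H x - k)\<^sup>2"
      using AE_A uH by eventually_elim (use A_sub in \<open>auto simp: indicator_def\<close>)
  qed
  have V_eq: "(LINT x|lebesgue_on A. norm (g x) powr t) = V"
    unfolding V_def
  proof (rule integral_lebesgue_on_eq_lborel[OF A_sets])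
    have "(\<lambda>x. indicator A x * norm (gB x) powr t) \<in> borel_measurable lebesgue"
      using iA gB by measurable
    moreover have "indicator A x * norm (gB x) powr t = indicator A x * norm (g x) powr t" for x
      using A_sub by (auto simp: indicator_def gB_def)
    ultimately show "(\<lambda>x. indicator A x * norm (g x) powr t) \<in> borel_measurable lebesgue"
      by (simp only:)
    show "(\<lambda>x. indicator AH x * norm (G x) powr t) \<in> borel_measurable borel"
      by measurable
    show "AE x in lebesgue. indicator A x * norm (g x) powr t = indicator AH x * norm (G x) powr t"
      using AE_A gG'' by eventually_elim (use A_sub in \<open>auto simp: indicator_def\<close>)
  qed
  have A_meas: "measure lebesgue A = measure lborel AH"
  proof -
    have "measure lebesgue A = measure lebesgue AH"
      using AE_A A_sets by (intro measure_eq_AE) auto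
    then show ?thesis by simp
  qed
  have d: "d = (1 / \<kappa>) * ((U + r powr t * V) powr (a / t) / r powr a * X powr (b / 2) * measure lborel AH powr e)"
    unfolding d_def U_eq X_eq V_eq A_meas \<kappa>_def by simp

  have H_le: "H x \<le> k + d" if "x \<in> ball y (r / 2)" for x
  proof -
    have "\<kappa> * (H x - k) \<le> (U + r powr t * V) powr (a / t) / r powr a * X powr (b / 2) * measure lborel AH powr e"
      using sup_bound_continuous[OF wG gt t r H abe that, of k]
      unfolding \<kappa>_def U_def V_def X_def AH_def .
    then have "(1 / \<kappa>) * (\<kappa> * (H x - k)) \<le> d"
      unfolding d using \<kappa> by (intro mult_left_mono) auto
    then show ?thesis using \<kappa> by simp
  qed
  have sub2: "ball y (r / 2) \<subseteq> ?B" using r by (intro subset_ball) simp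
  show ?thesis
    unfolding sup_ball_def
  proof (rule esssup_I)
    have "u \<in> borel_measurable (lebesgue_on \<Omega>)" using u by (simp add: W1p_def Lp_def)
    then have "u \<in> borel_measurable (lebesgue_on (ball y (r / 2)))"
      by (rule measurable_restrict_mono) (use sub2 BS in blast)
    then show "(\<lambda>x. ereal (u x)) \<in> borel_measurable (lebesgue_on (ball y (r / 2)))"
      by measurable
    show "AE x in lebesgue_on (ball y (r / 2)). ereal (u x) \<le> ereal (k + d)"
    proof (subst AE_restrict_space_iff)
      show "AE x in lebesgue. x \<in> ball y (r / 2) \<longrightarrow> ereal (u x) \<le> ereal (k + d)"
        using uH by eventually_elim (use H_le sub2 in auto)
    qed simp
  qed
qed

theorem theorem3p1:
  fixes N p t \<xi> \<eta> \<mu> :: real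
  assumes "N = real CARD('n::finite)" and "N \<ge> 2"
    and "p > 1" and "t > N" and "\<xi> > 0" and "\<eta> > 0"
  shows "\<exists>c>0. \<forall>(q::real) (s::real) (sstar::real) (\<beta>::real) (\<theta>::real). \<forall>(\<Omega> :: (real^'n) set) u g.
    2 < q \<and> q < 2 * p \<and>
    s = 2 * q * N * (p - 1) / (N * (2 * p - q) + 2 * q * (p - 1)) \<and>
    sstar = N * s / (N - s) \<and>
    \<beta> = 1 - 2 / q + (1 - s / t) * (sstar / s) * ((2 * p - q) / (p * q)) \<and>
    \<theta> = (1 / p + sqrt (1 / p\<^sup>2 + 4 * \<beta>)) / 2 \<and>
    \<xi> / p + \<eta> = \<theta> * \<xi> \<and> \<beta> * \<xi> = \<theta> * \<eta> \<and>
    \<mu> = (2 * ((p - 1) / p) * \<xi> + 2 * \<eta>) / (\<theta> - 1) \<and>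
    open \<Omega> \<and> bounded \<Omega> \<and> Ck_boundary 1 \<Omega> \<and>
    u \<in> W1p t \<Omega> \<and> weak_gradient \<Omega> u g \<longrightarrow>
    (\<forall>k y r. y \<in> \<Omega> \<and> 0 < r \<and> r < infdist y (frontier \<Omega>) \<longrightarrow>
      (let A = Aplus u y k r;
           d = c / r powr (\<xi> * (p - 1) / (\<eta> * p))
               * ((LINT x|lebesgue_on A. \<bar>u x - k\<bar> powr t)
                  + r powr t * (LINT x|lebesgue_on A. norm (g x) powr t))
                 powr (\<xi> * (p - 1) / (t * p * \<eta>))
               * (LINT x|lebesgue_on A. \<bar>u x - k\<bar>\<^sup>2) powr (\<xi> * (\<theta> - 1) / (2 * \<eta>))
               * measure lebesgue A powr ((\<theta> - 1) / 2)
       in sup_ball u y (r / 2) \<le> ereal (k + d)))"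
proof -
  \<comment> \<open>the value that the system for \<open>\<xi>\<close> and \<open>\<eta>\<close> forces on \<open>\<theta>\<close>; the constant must be chosen before \<open>\<theta>\<close> is given\<close>
  define \<theta>0 where "\<theta>0 = 1 / p + \<eta> / \<xi>"
  define a where "a = \<xi> * (p - 1) / (\<eta> * p)"
  define b where "b = \<xi> * (\<theta>0 - 1) / \<eta>"
  define e where "e = (\<theta>0 - 1) / 2"
  define \<kappa> where "\<kappa> = sup_const TYPE('n) t a b e"
  have t: "real CARD('n) < t" using assms(1,4) by simp
  have \<kappa>: "0 < \<kappa>" unfolding \<kappa>_def by (rule sup_const_pos[OF t])
  show ?thesis
  proof (intro exI[of _ "1 / \<kappa>"] conjI allI impI)
    show "0 < 1 / \<kappa>" using \<kappa> by simp
    fix q s sstar \<beta> \<theta> :: real and \<Omega> :: "(real^'n) set" and u g k y r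
    assume P: "2 < q \<and> q < 2 * p \<and>
      s = 2 * q * N * (p - 1) / (N * (2 * p - q) + 2 * q * (p - 1)) \<and>
      sstar = N * s / (N - s) \<and>
      \<beta> = 1 - 2 / q + (1 - s / t) * (sstar / s) * ((2 * p - q) / (p * q)) \<and>
      \<theta> = (1 / p + sqrt (1 / p\<^sup>2 + 4 * \<beta>)) / 2 \<and>
      \<xi> / p + \<eta> = \<theta> * \<xi> \<and> \<beta> * \<xi> = \<theta> * \<eta> \<and>
      \<mu> = (2 * ((p - 1) / p) * \<xi> + 2 * \<eta>) / (\<theta> - 1) \<and>
      open \<Omega> \<and> bounded \<Omega> \<and> Ck_boundary 1 \<Omega> \<and> u \<in> W1p t \<Omega> \<and> weak_gradient \<Omega> u g"
      and Q: "y \<in> \<Omega> \<and> 0 < r \<and> r < infdist y (frontier \<Omega>)"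
    have q: "2 < q" "q < 2 * p"
      and s: "s = 2 * q * N * (p - 1) / (N * (2 * p - q) + 2 * q * (p - 1))"
      and sstar: "sstar = N * s / (N - s)"
      and \<beta>: "\<beta> = 1 - 2 / q + (1 - s / t) * (sstar / s) * ((2 * p - q) / (p * q))"
      and sys: "\<xi> / p + \<eta> = \<theta> * \<xi>" "\<beta> * \<xi> = \<theta> * \<eta>"
      and \<Omega>: "open \<Omega>" and u: "u \<in> W1p t \<Omega>" and w: "weak_gradient \<Omega> u g"
      using P by blast+
    note ids = exponent_identities[OF assms(2-6) q s sstar \<beta> sys]
    have \<theta>: "\<theta>0 = \<theta>" using ids(1) by (simp add: \<theta>0_def)
    have r: "0 < r" and sub: "cball y r \<subseteq> \<Omega>"
      using Q cball_subset_if_less_infdist_frontier by blast+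
    have abe: "0 \<le> a" "0 \<le> b" "0 \<le> e" "a + b = 1"
      "real CARD('n) * (b / 2 + e) = a * (1 - real CARD('n) / t)"
      using assms ids unfolding a_def b_def e_def \<theta> by auto
    have exps: "\<xi> * (p - 1) / (t * p * \<eta>) = a / t" "\<xi> * (\<theta> - 1) / (2 * \<eta>) = b / 2" "(\<theta> - 1) / 2 = e"
      by (simp_all add: a_def b_def e_def \<theta> mult_ac)
    show "let A = Aplus u y k r;
           d = (1 / \<kappa>) / r powr (\<xi> * (p - 1) / (\<eta> * p))
               * ((LINT x|lebesgue_on A. \<bar>u x - k\<bar> powr t)
                  + r powr t * (LINT x|lebesgue_on A. norm (g x) powr t))
                 powr (\<xi> * (p - 1) / (t * p * \<eta>))
               * (LINT x|lebesgue_on A. \<bar>u x - k\<bar>\<^sup>2) powr (\<xi> * (\<theta> - 1) / (2 * \<eta>))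
               * measure lebesgue A powr ((\<theta> - 1) / 2)
       in sup_ball u y (r / 2) \<le> ereal (k + d)"
      unfolding Let_def exps a_def[symmetric] \<kappa>_def
      by (rule sup_ball_bound[OF t \<Omega> u w r sub abe])
  qed
qed

end
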